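(* Let $(a,u,v):\mathbb{R}^2\to su(n)\times su(n)\times su(n)$ be a smooth solution, in the light cone coordinates $(\xi,\eta)$, of the $-1$ flow equation associated to $SU(n)$: $$a_\eta=0,\qquad u_\eta=[a,v],\qquad v_\xi=-[u,v].$$ For $\lambda\in\mathbb{C}\setminus\{0\}$ let $\Phi(\xi,\eta,\lambda)$ be the trivialization of the connection $1$-form $\theta_\lambda=(a(\xi,\eta)\lambda+u(\xi,\eta))\,d\xi+\lambda^{-1}v(\xi,\eta)\,d\eta$, and write $\Phi(\lambda)(\xi,\eta)=\Phi(\xi,\eta,\lambda)$. Then $s=\Phi(-1)\Phi(1)^{-1}$ is a wave map from $\mathbb{R}^{1,1}$ to $SU(n)$, and $$s^{-1}s_\xi=-2\,\Phi(1)\,a\,\Phi(1)^{-1},\qquad s^{-1}s_\eta=-2\,\Phi(1)\,v\,\Phi(1)^{-1}.$$ (This $s$ is called the wave map corresponding to $(a,u,v)$.) Conversely, suppose $s:\mathbb{R}^{1,1}\to SU(n)$ is a wave map with $s(0,0)=\mathrm{I}$. Let $\psi(\xi,\eta)$ be the solution of $\psi^{-1}\psi_\eta=\frac12 s^{-1}s_\eta$ with $\psi(\xi,0)=\mathrm{I}$, and set $$a(\xi,\eta)=\tfrac12(s^{-1}s_\xi)(\xi,0),\qquad u(\xi,\eta)=a(\xi)-(\psi_\xi\psi^{-1})(\xi,\eta),\qquad v=-\tfrac12\,\psi\, s^{-1}s_\eta\,\psi^{-1},$$ where $a(\xi)$ denotes $a(\xi,\eta)$, which is independent of $\eta$. Then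 $(-a,u,v)$ is a solution of the $-1$ flow equation associated to $SU(n)$, and $s$ is the wave map corresponding to $(-a,u,v)$.
   Context: $\mathbb{R}^{1,1}$ has coordinates $(x,t)$ and light cone coordinates $\xi=\frac{x+t}{2}$, $\eta=\frac{x-t}{2}$. A wave map $s:\mathbb{R}^{1,1}\to SU(n)$ is a smooth map satisfying $(s^{-1}s_t)_t=(s^{-1}s_x)_x$, equivalently $(s^{-1}s_\xi)_\eta=-(s^{-1}s_\eta)_\xi$. A connection $1$-form $A\,d\xi+B\,d\eta$ with $A,B:\mathbb{R}^2\to gl(n,\mathbb{C})$ is flat if $A_\eta-B_\xi=[A,B]$; its trivialization is then the unique $E:\mathbb{R}^2\to GL(n,\mathbb{C})$ with $E_\xi=EA$, $E_\eta=EB$, $E(0,0)=\mathrm{I}$. The form $\theta_\lambda$ is flat for every $\lambda\in\mathbb{C}\setminus\{0\}$ when $(a,u,v)$ solves the $-1$ flow equation. *)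

theory Defs
  imports "HOL-Analysis.Analysis"
begin

definition partial1 :: "(real \<times> real \<Rightarrow> 'b::real_normed_vector) \<Rightarrow> real \<times> real \<Rightarrow> 'b" where
  "partial1 f p = vector_derivative (\<lambda>x. f (x, snd p)) (at (fst p))"

definition partial2 :: "(real \<times> real \<Rightarrow> 'b::real_normed_vector) \<Rightarrow> real \<times> real \<Rightarrow> 'b" where
  "partial2 f p = vector_derivative (\<lambda>y. f (fst p, y)) (at (snd p))"

primrec C_order :: "nat \<Rightarrow> (real \<times> real \<Rightarrow> 'b::real_normed_vector) \<Rightarrow> bool" where
  "C_order 0 f \<longleftrightarrow> continuous_on UNIV f"
| "C_order (Suc k) f \<longleftrightarrow>
     f differentiable_on UNIV \<and> C_order k (partial1 f) \<and> C_order k (partial2 f)"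

definition smooth :: "(real \<times> real \<Rightarrow> 'b::real_normed_vector) \<Rightarrow> bool" where
  "smooth f \<longleftrightarrow> (\<forall>k. C_order k f)"

definition conj_transpose :: "complex^'n^'m \<Rightarrow> complex^'m^'n" where
  "conj_transpose A = (\<chi> i j. cnj (A $ j $ i))"

definition SU :: "(complex^'n^'n) set" where
  "SU = {A. conj_transpose A ** A = mat 1 \<and> A ** conj_transpose A = mat 1 \<and> det A = 1}"

definition su :: "(complex^'n^'n) set" where
  "su = {A. conj_transpose A = - A \<and> trace A = 0}"

definition commutator :: "complex^'n^'n \<Rightarrow> complex^'n^'n \<Rightarrow> complex^'n^'n" where
  "commutator A B = A ** B - B ** A"

text \<open>The library's \<^term>\<open>(*s)\<close> scales a vector by its entry type, which for a matrix is the type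
  of rows; so multiplication of a complex matrix by a complex number is defined separately.\<close>

definition cscale :: "complex \<Rightarrow> complex^'n^'n \<Rightarrow> complex^'n^'n" where
  "cscale c A = (\<chi> i j. c * A $ i $ j)"

text \<open>Points of \<open>\<real>\<^sup>1\<^sup>,\<^sup>1\<close> are pairs \<open>(x, t)\<close>; the map below gives their light cone coordinates
  \<open>(\<xi>, \<eta>)\<close>.  A map \<open>s\<close> written in light cone coordinates is the map
  \<^term>\<open>s \<circ> light_cone\<close> on \<open>\<real>\<^sup>1\<^sup>,\<^sup>1\<close>.\<close>

definition light_cone :: "real \<times> real \<Rightarrow> real \<times> real" where
  "light_cone = (\<lambda>(x, t). ((x + t) / 2, (x - t) / 2))"

text \<open>In the coordinates \<open>(x, t)\<close>: \<open>(s\<^sup>-\<^sup>1 s\<^sub>t)\<^sub>t = (s\<^sup>-\<^sup>1 s\<^sub>x)\<^sub>x\<close>.\<close>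

definition wave_map :: "(real \<times> real \<Rightarrow> complex^'n^'n) \<Rightarrow> bool" where
  "wave_map s \<longleftrightarrow> smooth s \<and> (\<forall>p. s p \<in> SU) \<and>
     (\<forall>p. partial2 (\<lambda>q. matrix_inv (s q) ** partial2 s q) p
        = partial1 (\<lambda>q. matrix_inv (s q) ** partial1 s q) p)"

text \<open>From here on, functions on the plane are in light cone coordinates \<open>(\<xi>, \<eta>)\<close>.\<close>

definition minus_one_flow_solution ::
  "(real \<times> real \<Rightarrow> complex^'n^'n) \<Rightarrow> (real \<times> real \<Rightarrow> complex^'n^'n) \<Rightarrow>
   (real \<times> real \<Rightarrow> complex^'n^'n) \<Rightarrow> bool" where
  "minus_one_flow_solution a u v \<longleftrightarrow>
     smooth a \<and> smooth u \<and> smooth v \<and> (\<forall>p. a p \<in> su \<and> u p \<in> su \<and> v p \<in> su) \<and>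
     (\<forall>p. partial2 a p = 0 \<and>
          partial2 u p = commutator (a p) (v p) \<and>
          partial1 v p = - commutator (u p) (v p))"

definition is_trivialization ::
  "(real \<times> real \<Rightarrow> complex^'n^'n) \<Rightarrow> (real \<times> real \<Rightarrow> complex^'n^'n) \<Rightarrow>
   (real \<times> real \<Rightarrow> complex^'n^'n) \<Rightarrow> bool" where
  "is_trivialization A B E \<longleftrightarrow> E (0, 0) = mat 1 \<and>
     (\<forall>\<xi> \<eta>. invertible (E (\<xi>, \<eta>)) \<and>
        ((\<lambda>x. E (x, \<eta>)) has_vector_derivative E (\<xi>, \<eta>) ** A (\<xi>, \<eta>)) (at \<xi>) \<and>
        ((\<lambda>y. E (\<xi>, y)) has_vector_derivative E (\<xi>, \<eta>) ** B (\<xi>, \<eta>)) (at \<eta>))"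

text \<open>The trivialization of \<open>A d\<xi> + B d\<eta>\<close>; meaningful when this form is smooth and flat.\<close>

definition trivialization ::
  "(real \<times> real \<Rightarrow> complex^'n^'n) \<Rightarrow> (real \<times> real \<Rightarrow> complex^'n^'n) \<Rightarrow>
   real \<times> real \<Rightarrow> complex^'n^'n" where
  "trivialization A B = (THE E. is_trivialization A B E)"

definition flow_trivialization ::
  "(real \<times> real \<Rightarrow> complex^'n^'n) \<Rightarrow> (real \<times> real \<Rightarrow> complex^'n^'n) \<Rightarrow>
   (real \<times> real \<Rightarrow> complex^'n^'n) \<Rightarrow> complex \<Rightarrow> real \<times> real \<Rightarrow> complex^'n^'n" where
  "flow_trivialization a u v z =
     trivialization (\<lambda>p. cscale z (a p) + u p) (\<lambda>p. cscale (inverse z) (v p))"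

definition corresponding_wave_map ::
  "(real \<times> real \<Rightarrow> complex^'n^'n) \<Rightarrow> (real \<times> real \<Rightarrow> complex^'n^'n) \<Rightarrow>
   (real \<times> real \<Rightarrow> complex^'n^'n) \<Rightarrow> real \<times> real \<Rightarrow> complex^'n^'n" where
  "corresponding_wave_map a u v p =
     flow_trivialization a u v (- 1) p ** matrix_inv (flow_trivialization a u v 1 p)"

text \<open>\<open>\<psi>\<^sup>-\<^sup>1 \<psi>\<^sub>\<eta> = (1/2) s\<^sup>-\<^sup>1 s\<^sub>\<eta>\<close> with \<open>\<psi>(\<xi>, 0) = I\<close>; no regularity of \<open>\<psi>\<close> in \<open>\<xi>\<close> is required.\<close>

definition is_half_solution ::
  "(real \<times> real \<Rightarrow> complex^'n^'n) \<Rightarrow> (real \<times> real \<Rightarrow> complex^'n^'n) \<Rightarrow> bool" where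
  "is_half_solution s \<psi> \<longleftrightarrow> (\<forall>\<xi>. \<psi> (\<xi>, 0) = mat 1) \<and>
     (\<forall>\<xi> \<eta>. invertible (\<psi> (\<xi>, \<eta>)) \<and> (\<lambda>y. \<psi> (\<xi>, y)) differentiable (at \<eta>) \<and>
        matrix_inv (\<psi> (\<xi>, \<eta>)) ** partial2 \<psi> (\<xi>, \<eta>)
          = (1/2) *\<^sub>R (matrix_inv (s (\<xi>, \<eta>)) ** partial2 s (\<xi>, \<eta>)))"

end

theory Submission
  imports Defs
begin

text \<open>Write \<open>E = \<Phi>(1)\<close> and \<open>F = \<Phi>(-1)\<close>. Both are \<open>SU(n)\<close>-valued, and differentiating \<open>s = F E\<^sup>-\<^sup>1\<close> gives the
  formulas for \<open>s\<^sup>-\<^sup>1 s\<^sub>\<xi>\<close> and \<open>s\<^sup>-\<^sup>1 s\<^sub>\<eta>\<close>, from which the wave map equation follows by the flow equations.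
  Conversely, the wave map equation together with the flatness of \<open>s\<^sup>-\<^sup>1 ds\<close> makes \<open>\<psi> s\<^sup>-\<^sup>1 s\<^sub>\<xi> \<psi>\<^sup>-\<^sup>1\<close>
  independent of \<open>\<eta>\<close>, so it equals \<open>2 a\<close>; then \<open>E = \<psi>\<^sup>-\<^sup>1\<close> and \<open>F = s \<psi>\<^sup>-\<^sup>1\<close> trivialize the connections for
  \<open>\<lambda> = 1\<close> and \<open>\<lambda> = -1\<close>, and the sum and the difference of the two flatness conditions are the flow
  equations.

  Existence and smoothness rest on the equation \<open>Y\<^sub>y = Y A(x, y)\<close>, \<open>Y(x, 0) = I\<close>, with \<open>A\<close> in \<open>su(n)\<close>. The Picard
  series converges locally uniformly in both variables to a continuous solution, which is unitary; then
  \<open>Y\<^sub>x = (\<integral>\<^sub>0\<^sup>y Y A\<^sub>x Y\<^sup>* dt) Y\<close>, and every derivative of \<open>Y\<close> is obtained from this formula by induction on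
  the order.\<close>

section \<open>Partial derivatives\<close>

lemma partial1_eqI:
  "((\<lambda>t. f (t, y)) has_vector_derivative d) (at x) \<Longrightarrow> partial1 f (x, y) = d"
  unfolding partial1_def by (simp add: vector_derivative_at)

lemma partial2_eqI:
  "((\<lambda>t. f (x, t)) has_vector_derivative d) (at y) \<Longrightarrow> partial2 f (x, y) = d"
  unfolding partial2_def by (simp add: vector_derivative_at)

lemma has_partial1:
  assumes "f differentiable at (x, y)"
  shows "((\<lambda>t. f (t, y)) has_vector_derivative partial1 f (x, y)) (at x)"
proof -
  have "((\<lambda>t. (t, y)) has_derivative (\<lambda>h. (h, 0))) (at x)"
    by (auto intro!: derivative_eq_intros)
  then have "(\<lambda>t. (t, y)) differentiable at x"
    by (rule differentiableI)
  from differentiable_chain_at[OF this, of f] assms have "(f \<circ> (\<lambda>t. (t, y))) differentiable at x"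
    by simp
  then show ?thesis
    unfolding partial1_def by (simp add: o_def vector_derivative_works)
qed

lemma has_partial2:
  assumes "f differentiable at (x, y)"
  shows "((\<lambda>t. f (x, t)) has_vector_derivative partial2 f (x, y)) (at y)"
proof -
  have "((\<lambda>t. (x, t)) has_derivative (\<lambda>h. (0, h))) (at y)"
    by (auto intro!: derivative_eq_intros)
  then have "(\<lambda>t. (x, t)) differentiable at y"
    by (rule differentiableI)
  from differentiable_chain_at[OF this, of f] assms have "(f \<circ> (\<lambda>t. (x, t))) differentiable at y"
    by simp
  then show ?thesis
    unfolding partial2_def by (simp add: o_def vector_derivative_works)
qed

text \<open>Continuity of the second partial makes the mean value estimate in that variable uniform,
  and with the mere existence of the first partial this gives the total derivative.
  \<open>blinfun_scaleR_left\<close> turns the vector \<open>h (x, y)\<close> into the linear map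
  \<open>t \<mapsto> t *\<^sub>R h (x, y)\<close>, whose continuity is then that of
  \<open>h\<close>.\<close>

lemma differentiable_at_partials:
  fixes f :: "real \<times> real \<Rightarrow> 'b::real_normed_vector"
  assumes 1: "\<And>x y. ((\<lambda>t. f (t, y)) has_vector_derivative g (x, y)) (at x)"
    and 2: "\<And>x y. ((\<lambda>t. f (x, t)) has_vector_derivative h (x, y)) (at y)"
    and h: "continuous_on UNIV h"
  shows "(f has_derivative (\<lambda>(s, t). s *\<^sub>R g (x, y) + t *\<^sub>R h (x, y))) (at (x, y))"
proof -
  have sc: "continuous_on UNIV (\<lambda>p. blinfun_scaleR_left (h p))"
    using h by (intro continuous_intros)
  have "((\<lambda>(x, y). f (x, y)) has_derivative
      (\<lambda>(s, t). s *\<^sub>R g (x, y) + blinfun_scaleR_left (h (x, y)) t)) (at (x, y) within UNIV \<times> UNIV)"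
  proof (rule has_derivative_partialsI)
    show "((\<lambda>x. f (x, y)) has_derivative (\<lambda>s. s *\<^sub>R g (x, y))) (at x)"
      using 1 unfolding has_vector_derivative_def .
    show "((\<lambda>y. f (x, y)) has_derivative blinfun_scaleR_left (h (x, y))) (at y)" for x y
      using 2[of x y] unfolding has_vector_derivative_def by simp
    show "continuous (at (x, y) within UNIV \<times> UNIV) (\<lambda>(x, y). blinfun_scaleR_left (h (x, y)))"
      using sc by (simp add: continuous_on_eq_continuous_within case_prod_unfold)
  qed auto
  then show ?thesis
    by (simp add: case_prod_unfold)
qed

section \<open>The classes C^k and their closure properties\<close>

lemma C_order_imp_continuous: "C_order k f \<Longrightarrow> continuous_on UNIV f"
  by (cases k) (auto intro: differentiable_imp_continuous_on)

text \<open>The way every regularity claim below is proved: name explicit formulas for the two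
  partials and show these to be of order \<open>k\<close>. The formulas may involve \<open>f\<close>
  itself, which permits bootstrapping.\<close>

lemma C_order_SucI:
  assumes "\<And>x y. ((\<lambda>t. f (t, y)) has_vector_derivative g (x, y)) (at x)"
    and "\<And>x y. ((\<lambda>t. f (x, t)) has_vector_derivative h (x, y)) (at y)"
    and "C_order k g" "C_order k h"
  shows "C_order (Suc k) f"
proof -
  have "partial1 f = g"
    using partial1_eqI[OF assms(1)] by (simp add: fun_eq_iff)
  moreover have "partial2 f = h"
    using partial2_eqI[OF assms(2)] by (simp add: fun_eq_iff)
  moreover have "f differentiable_on UNIV"
    unfolding differentiable_on_def
    using differentiable_at_partials[OF assms(1,2) C_order_imp_continuous[OF assms(4)]]
    by (auto simp: differentiable_def)
  ultimately show ?thesis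
    using assms(3,4) by simp
qed

lemma C_order_Suc_partial1:
  "C_order (Suc k) f \<Longrightarrow> ((\<lambda>t. f (t, y)) has_vector_derivative partial1 f (x, y)) (at x)"
  by (rule has_partial1) (simp add: differentiable_on_def)

lemma C_order_Suc_partial2:
  "C_order (Suc k) f \<Longrightarrow> ((\<lambda>t. f (x, t)) has_vector_derivative partial2 f (x, y)) (at y)"
  by (rule has_partial2) (simp add: differentiable_on_def)

lemma C_order_SucD: "C_order (Suc k) f \<Longrightarrow> C_order k f"
proof (induction k arbitrary: f)
  case 0
  then show ?case by (simp add: differentiable_imp_continuous_on)
next
  case (Suc k)
  then show ?case by (metis C_order.simps(2))
qed

lemma smooth_C_order: "smooth f \<Longrightarrow> C_order k f"
  by (simp add: smooth_def)

lemma smooth_continuous: "smooth f \<Longrightarrow> continuous_on UNIV f"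
  using C_order_imp_continuous smooth_C_order by blast

lemma smooth_partial1: "smooth f \<Longrightarrow> smooth (partial1 f)"
  unfolding smooth_def by (metis C_order.simps(2))

lemma smooth_partial2: "smooth f \<Longrightarrow> smooth (partial2 f)"
  unfolding smooth_def by (metis C_order.simps(2))

lemma smooth_has_partial1:
  "smooth f \<Longrightarrow> ((\<lambda>t. f (t, y)) has_vector_derivative partial1 f (x, y)) (at x)"
  unfolding smooth_def using C_order_Suc_partial1 by blast

lemma smooth_has_partial2:
  "smooth f \<Longrightarrow> ((\<lambda>t. f (x, t)) has_vector_derivative partial2 f (x, y)) (at y)"
  unfolding smooth_def using C_order_Suc_partial2 by blast

lemma C_order_add: "C_order k f \<Longrightarrow> C_order k g \<Longrightarrow> C_order k (\<lambda>p. f p + g p)"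
proof (induction k arbitrary: f g)
  case (Suc k)
  show ?case
  proof (rule C_order_SucI)
    show "((\<lambda>t. f (t, y) + g (t, y)) has_vector_derivative
        (\<lambda>p. partial1 f p + partial1 g p) (x, y)) (at x)" for x y
      using Suc.prems by (auto intro!: has_vector_derivative_add C_order_Suc_partial1)
    show "((\<lambda>t. f (x, t) + g (x, t)) has_vector_derivative
        (\<lambda>p. partial2 f p + partial2 g p) (x, y)) (at y)" for x y
      using Suc.prems by (auto intro!: has_vector_derivative_add C_order_Suc_partial2)
  qed (use Suc in auto)
qed (auto intro: continuous_intros)

lemma C_order_bounded_linear:
  assumes L: "bounded_linear L"
  shows "C_order k f \<Longrightarrow> C_order k (\<lambda>p. L (f p))"
proof (induction k arbitrary: f)
  case 0
  then show ?case using bounded_linear.continuous_on[OF L] by auto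
next
  case (Suc k)
  show ?case
  proof (rule C_order_SucI)
    show "((\<lambda>t. L (f (t, y))) has_vector_derivative (\<lambda>p. L (partial1 f p)) (x, y)) (at x)" for x y
      using Suc.prems by (auto intro!: bounded_linear.has_vector_derivative[OF L] C_order_Suc_partial1)
    show "((\<lambda>t. L (f (x, t))) has_vector_derivative (\<lambda>p. L (partial2 f p)) (x, y)) (at y)" for x y
      using Suc.prems by (auto intro!: bounded_linear.has_vector_derivative[OF L] C_order_Suc_partial2)
  qed (use Suc in auto)
qed

lemma C_order_bounded_bilinear:
  assumes B: "bounded_bilinear B"
  shows "C_order k f \<Longrightarrow> C_order k g \<Longrightarrow> C_order k (\<lambda>p. B (f p) (g p))"
proof (induction k arbitrary: f g)
  case 0
  then show ?case using bounded_bilinear.continuous_on[OF B] by auto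
next
  case (Suc k)
  \<comment> \<open>The product rule leaves one factor undifferentiated in each term, so the factors
    themselves are needed at order \<open>k\<close>.\<close>
  have low: "C_order k f" "C_order k g"
    using Suc.prems C_order_SucD by blast+
  show ?case
  proof (rule C_order_SucI)
    show "((\<lambda>t. B (f (t, y)) (g (t, y))) has_vector_derivative
        (\<lambda>p. B (f p) (partial1 g p) + B (partial1 f p) (g p)) (x, y)) (at x)" for x y
      using Suc.prems
      by (auto intro!: bounded_bilinear.has_vector_derivative[OF B] C_order_Suc_partial1)
    show "((\<lambda>t. B (f (x, t)) (g (x, t))) has_vector_derivative
        (\<lambda>p. B (f p) (partial2 g p) + B (partial2 f p) (g p)) (x, y)) (at y)" for x y
      using Suc.prems
      by (auto intro!: bounded_bilinear.has_vector_derivative[OF B] C_order_Suc_partial2)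
  qed (use Suc low in \<open>auto intro!: C_order_add\<close>)
qed

lemma smooth_add: "smooth f \<Longrightarrow> smooth g \<Longrightarrow> smooth (\<lambda>p. f p + g p)"
  by (simp add: smooth_def C_order_add)

lemma smooth_bounded_linear: "bounded_linear L \<Longrightarrow> smooth f \<Longrightarrow> smooth (\<lambda>p. L (f p))"
  by (simp add: smooth_def C_order_bounded_linear)

lemma smooth_bounded_bilinear:
  "bounded_bilinear B \<Longrightarrow> smooth f \<Longrightarrow> smooth g \<Longrightarrow> smooth (\<lambda>p. B (f p) (g p))"
  by (simp add: smooth_def C_order_bounded_bilinear)

lemma smooth_scaleR: "smooth f \<Longrightarrow> smooth (\<lambda>p. c *\<^sub>R f p)"
  by (rule smooth_bounded_linear[OF bounded_linear_scaleR_right])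

lemma smooth_uminus: "smooth f \<Longrightarrow> smooth (\<lambda>p. - f p)"
  using smooth_scaleR[of f "- 1"] by simp

lemma smooth_diff: "smooth f \<Longrightarrow> smooth g \<Longrightarrow> smooth (\<lambda>p. f p - g p)"
  using smooth_add[OF _ smooth_uminus, of f g] by simp

section \<open>Linear changes of variables\<close>

lemma has_vector_derivative_along_line:
  assumes "C_order (Suc k) f"
  shows "((\<lambda>t. f (p + a * t, q + b * t)) has_vector_derivative
    a *\<^sub>R partial1 f (p + a * t, q + b * t) + b *\<^sub>R partial2 f (p + a * t, q + b * t)) (at t)"
proof -
  have f: "(f has_derivative (\<lambda>(s, t'). s *\<^sub>R partial1 f (p + a * t, q + b * t)
      + t' *\<^sub>R partial2 f (p + a * t, q + b * t))) (at (p + a * t, q + b * t))"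
    using assms C_order_Suc_partial1[OF assms] C_order_Suc_partial2[OF assms]
    by (intro differentiable_at_partials) (auto dest: C_order_imp_continuous)
  have "((\<lambda>t. (p + a * t, q + b * t)) has_vector_derivative (a, b)) (at t)"
    by (auto intro!: derivative_eq_intros simp: has_vector_derivative_def)
  from vector_derivative_diff_chain_within[OF this has_derivative_at_withinI[OF f]]
  show ?thesis
    by (simp add: o_def)
qed

text \<open>The substitution may be singular. It serves for \<open>light_cone\<close> and its
  inverse, and also for freezing or renaming a coordinate.\<close>

lemma C_order_linear_substitution:
  "C_order k f \<Longrightarrow> C_order k (\<lambda>p. f (a * fst p + b * snd p, c * fst p + d * snd p))"
proof (induction k arbitrary: f)
  case 0
  then have "continuous_on UNIV f" by simp
  then show ?case
    by (auto intro!: continuous_intros continuous_on_compose2[of UNIV f])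
next
  case (Suc k)
  let ?L = "\<lambda>p. (a * fst p + b * snd p, c * fst p + d * snd p)"
  show ?case
  proof (rule C_order_SucI)
    show "((\<lambda>t. f (?L (t, y))) has_vector_derivative
        (\<lambda>p. a *\<^sub>R partial1 f (?L p) + c *\<^sub>R partial2 f (?L p)) (x, y)) (at x)" for x y
      using has_vector_derivative_along_line[OF Suc.prems, of "b * y" a "d * y" c x]
      by (simp add: add.commute)
    show "((\<lambda>t. f (?L (x, t))) has_vector_derivative
        (\<lambda>p. b *\<^sub>R partial1 f (?L p) + d *\<^sub>R partial2 f (?L p)) (x, y)) (at y)" for x y
      using has_vector_derivative_along_line[OF Suc.prems, of "a * x" b "c * x" d y]
      by simp
  qed (use Suc in \<open>auto intro!: C_order_add C_order_bounded_linear[OF bounded_linear_scaleR_right]\<close>)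
qed

lemma smooth_linear_substitution:
  "smooth f \<Longrightarrow> smooth (\<lambda>p. f (a * fst p + b * snd p, c * fst p + d * snd p))"
  by (simp add: smooth_def C_order_linear_substitution)

section \<open>Integration in the second variable\<close>

text \<open>Rescaling to the unit interval makes \<open>\<integral>\<^sub>0\<^sup>y f (x, t) dt\<close> meaningful for negative \<open>y\<close> too, and turns
  it into an integral over a fixed domain depending on a parameter.\<close>

definition int2 :: "(real \<times> real \<Rightarrow> 'b::banach) \<Rightarrow> real \<times> real \<Rightarrow> 'b" where
  "int2 f p = snd p *\<^sub>R integral (cbox 0 1) (\<lambda>s::real. f (fst p, snd p * s))"

lemma int2_zero [simp]: "int2 f (x, 0) = 0"
  by (simp add: int2_def)

lemma continuous_int2:
  assumes "continuous_on UNIV f"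
  shows "continuous_on UNIV (int2 f)"
proof -
  have "continuous_on UNIV (\<lambda>p::real\<times>real. integral (cbox 0 1) (\<lambda>s::real. f (fst p, snd p * s)))"
    by (intro integral_continuous_on_param)
      (auto simp: case_prod_unfold intro!: continuous_intros continuous_on_compose2[OF assms])
  then show ?thesis
    unfolding int2_def by (intro continuous_intros)
qed

text \<open>The substitution \<open>t = y * s\<close> reduces this to the fundamental theorem of
  calculus on the unit interval. The symmetric interval covers both signs of \<open>y\<close>;
  derivatives within it suffice, as fits an antiderivative known only on a compact interval.\<close>

lemma int2_eqI:
  assumes F: "\<And>t. \<bar>t\<bar> \<le> \<bar>y\<bar> \<Longrightarrow> ((\<lambda>t. F t) has_vector_derivative f (x, t)) (at t within {- \<bar>y\<bar>..\<bar>y\<bar>})"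
  shows "int2 f (x, y) = F y - F 0"
proof -
  have "((\<lambda>s. y *\<^sub>R f (x, y * s)) has_integral F (y * 1) - F (y * 0)) {0..1}"
  proof (rule fundamental_theorem_of_calculus)
    fix s :: real assume s: "s \<in> {0..1}"
    have "((\<lambda>s. y * s) has_vector_derivative y) (at s within {0..1})"
      by (auto intro!: derivative_eq_intros simp: has_vector_derivative_def)
    moreover have le: "\<bar>y * r\<bar> \<le> \<bar>y\<bar>" if "r \<in> {0..1}" for r
      using that by (auto simp: abs_mult mult_left_le)
    then have "(\<lambda>s. y * s) ` {0..1} \<subseteq> {- \<bar>y\<bar>..\<bar>y\<bar>}"
      unfolding abs_le_iff image_subset_iff atLeastAtMost_iff by (simp add: minus_le_iff)
    then have "(F has_vector_derivative f (x, y * s)) (at (y * s) within (\<lambda>s. y * s) ` {0..1})"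
      by (rule has_vector_derivative_within_subset[OF F[OF le[OF s]]])
    ultimately show "((\<lambda>s. F (y * s)) has_vector_derivative y *\<^sub>R f (x, y * s)) (at s within {0..1})"
      using vector_diff_chain_within[of "\<lambda>s. y * s" y s "{0..1}" F] by (simp add: o_def)
  qed simp
  then show ?thesis
    unfolding int2_def by (simp add: integral_unique flip: integral_cmul)
qed

lemma int2_has_partial2:
  assumes "continuous_on UNIV f"
  shows "((\<lambda>t. int2 f (x, t)) has_vector_derivative f (x, y)) (at y)"
proof -
  \<comment> \<open>The margin 1 puts \<open>y\<close> in the interior, where the derivative within
    the interval becomes a full derivative.\<close>
  define r where "r = \<bar>y\<bar> + 1"
  have "continuous_on {- r..r} (\<lambda>t. f (x, t))"
    by (intro continuous_on_compose2[OF assms] continuous_intros) auto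
  then obtain F where F: "\<And>t. t \<in> {- r..r} \<Longrightarrow>
      (F has_vector_derivative f (x, t)) (at t within {- r..r})"
    using antiderivative_continuous by blast
  have eq: "F t - F 0 = int2 f (x, t)" if "t \<in> {- r<..<r}" for t
    using that
    by (intro int2_eqI[symmetric] has_vector_derivative_within_subset[OF F]) auto
  have y: "y \<in> {- r<..<r}"
    unfolding r_def by auto
  have "(F has_vector_derivative f (x, y)) (at y)"
    using F[of y] y at_within_interior[of y "{- r..r}"] by auto
  then have "((\<lambda>t. F t - F 0) has_vector_derivative f (x, y)) (at y)"
    by (auto intro!: derivative_eq_intros)
  from has_vector_derivative_transform_within_open[OF this _ y eq] show ?thesis
    by auto
qed

lemma eq_int2I:
  assumes "\<And>t. ((\<lambda>t. F (x, t)) has_vector_derivative f (x, t)) (at t)"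
  shows "F (x, y) = F (x, 0) + int2 f (x, y)"
proof -
  have "int2 f (x, y) = F (x, y) - F (x, 0)"
    by (rule int2_eqI[OF has_vector_derivative_at_within[OF assms]])
  then show ?thesis by simp
qed

lemma int2_has_partial1:
  assumes "\<And>x y. ((\<lambda>t. f (t, y)) has_vector_derivative g (x, y)) (at x)"
    and f: "continuous_on UNIV f" and g: "continuous_on UNIV g"
  shows "((\<lambda>t. int2 f (t, y)) has_vector_derivative int2 g (x, y)) (at x)"
proof -
  have "((\<lambda>t. integral (cbox 0 1) (\<lambda>s::real. f (t, y * s)))
      has_vector_derivative integral (cbox 0 1) (\<lambda>s. g (x, y * s))) (at x within UNIV)"
  proof (rule leibniz_rule_vector_derivative)
    show "((\<lambda>x. f (x, y * t)) has_vector_derivative g (x, y * t)) (at x within UNIV)" for x t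
      using assms(1) by simp
    show "(\<lambda>s. f (x, y * s)) integrable_on cbox 0 1" for x
      by (intro integrable_continuous continuous_on_compose2[OF f] continuous_intros) auto
    show "continuous_on (UNIV \<times> cbox 0 1) (\<lambda>(x, t). g (x, y * t))"
      by (auto simp: case_prod_unfold intro!: continuous_intros continuous_on_compose2[OF g])
  qed auto
  then show ?thesis
    unfolding int2_def by (auto intro!: derivative_eq_intros)
qed

text \<open>Integration commutes with the first partial and is undone by the second, so both
  partials of \<open>int2 f\<close> stay within reach of the induction hypothesis.\<close>

lemma C_order_int2: "C_order k f \<Longrightarrow> C_order k (int2 f)"
proof (induction k arbitrary: f)
  case 0
  then show ?case by (simp add: continuous_int2)
next
  case (Suc k)
  show ?case
  proof (rule C_order_SucI)
    show "((\<lambda>t. int2 f (t, y)) has_vector_derivative int2 (partial1 f) (x, y)) (at x)" for x y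
      using Suc.prems C_order_Suc_partial1[OF Suc.prems]
      by (intro int2_has_partial1) (auto dest: C_order_imp_continuous differentiable_imp_continuous_on)
    show "((\<lambda>t. int2 f (x, t)) has_vector_derivative f (x, y)) (at y)" for x y
      using C_order_imp_continuous[OF Suc.prems] by (rule int2_has_partial2)
  qed (use Suc in \<open>auto intro: C_order_SucD\<close>)
qed

lemma int2_cong:
  assumes "\<And>t. f (x, t) = g (x, t)"
  shows "int2 f (x, y) = int2 g (x, y)"
  using assms by (simp add: int2_def)

text \<open>The integral of a power gains the factor \<open>1 / Suc n\<close>; iterated, these
  factors become the factorial in the majorant of the Picard series.\<close>

lemma int2_norm_le:
  assumes f: "continuous_on UNIV f"
    and le: "\<And>t. \<bar>t\<bar> \<le> \<bar>y\<bar> \<Longrightarrow> norm (f (x, t)) \<le> C * \<bar>t\<bar> ^ n"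
  shows "norm (int2 f (x, y)) \<le> C * \<bar>y\<bar> ^ Suc n / Suc n"
proof -
  have pow: "((\<lambda>s. C * \<bar>y\<bar> ^ n * s ^ n) has_integral (C * \<bar>y\<bar> ^ n / Suc n)) {0..1::real}"
  proof -
    have "((\<lambda>s. C * \<bar>y\<bar> ^ n * (s ^ Suc n / Suc n)) has_vector_derivative C * \<bar>y\<bar> ^ n * s ^ n)
        (at s within {0..1})" for s :: real
    proof -
      have "((\<lambda>s. C * \<bar>y\<bar> ^ n * (s ^ Suc n / Suc n)) has_real_derivative
          C * \<bar>y\<bar> ^ n * (Suc n * s ^ n / Suc n)) (at s within {0..1})"
        using DERIV_pow[of "Suc n" s "{0..1}"] by (intro DERIV_cmult DERIV_cdivide) simp
      then show ?thesis
        by (simp add: has_real_derivative_iff_has_vector_derivative)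
    qed
    then have "((\<lambda>s. C * \<bar>y\<bar> ^ n * s ^ n) has_integral C * \<bar>y\<bar> ^ n * (1 ^ Suc n / Suc n)
        - C * \<bar>y\<bar> ^ n * (0 ^ Suc n / Suc n)) {0..1::real}"
      by (intro fundamental_theorem_of_calculus) auto
    then show ?thesis by simp
  qed
  have "norm (integral (cbox 0 1) (\<lambda>s. f (x, y * s))) \<le> integral (cbox 0 1) (\<lambda>s. C * \<bar>y\<bar> ^ n * s ^ n)"
  proof (rule integral_norm_bound_integral)
    show "(\<lambda>s. f (x, y * s)) integrable_on cbox 0 1"
      by (intro integrable_continuous continuous_on_compose2[OF f] continuous_intros) auto
    fix s :: real assume s: "s \<in> cbox 0 1"
    then show "norm (f (x, y * s)) \<le> C * \<bar>y\<bar> ^ n * s ^ n"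
      using le[of "y * s"] by (simp add: abs_mult mult_left_le power_mult_distrib mult.assoc)
  qed (use pow in auto)
  also have "\<dots> = C * \<bar>y\<bar> ^ n / Suc n"
    using integral_unique[OF pow] unfolding cbox_interval .
  finally have "\<bar>y\<bar> * norm (integral (cbox 0 1) (\<lambda>s. f (x, y * s))) \<le> \<bar>y\<bar> * (C * \<bar>y\<bar> ^ n / Suc n)"
    by (intro mult_left_mono) auto
  then show ?thesis
    by (simp add: int2_def mult_ac)
qed

section \<open>Symmetry of mixed partials and Hadamard's lemma\<close>

text \<open>Recover \<open>f\<close> from its second partial by integration, differentiate under the
  integral in the first variable, then remove the integral by differentiating in the second.\<close>

lemma smooth_mixed_partials:
  fixes f :: "real \<times> real \<Rightarrow> 'b::banach"
  assumes f: "smooth f"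
  shows "partial2 (partial1 f) = partial1 (partial2 f)"
proof -
  have f21: "smooth (partial1 (partial2 f))"
    using f by (intro smooth_partial1 smooth_partial2)
  have dec: "f (x, y) = f (x, 0) + int2 (partial2 f) (x, y)" for x y
    using smooth_has_partial2[OF f] by (rule eq_int2I)
  have "((\<lambda>t. f (t, 0) + int2 (partial2 f) (t, y)) has_vector_derivative
      partial1 f (x, 0) + int2 (partial1 (partial2 f)) (x, y)) (at x)" for x y
    using f f21 by (intro has_vector_derivative_add smooth_has_partial1 int2_has_partial1)
      (auto intro: smooth_continuous smooth_partial2)
  then have "partial1 f (x, y) = partial1 f (x, 0) + int2 (partial1 (partial2 f)) (x, y)" for x y
    by (intro partial1_eqI) (simp only: dec[symmetric])
  then have eq: "(\<lambda>t. partial1 f (x, t)) = (\<lambda>t. partial1 f (x, 0) + int2 (partial1 (partial2 f)) (x, t))"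
    for x by (rule ext)
  have "((\<lambda>t. partial1 f (x, t)) has_vector_derivative partial1 (partial2 f) (x, y)) (at y)" for x y
    unfolding eq using int2_has_partial2[OF smooth_continuous[OF f21], of x y]
    by (auto intro!: derivative_eq_intros)
  from partial2_eqI[OF this] show ?thesis
    by (simp add: fun_eq_iff)
qed

text \<open>Hadamard's lemma with \<open>z\<close> fixed: \<open>h\<close> is the mean of the first
  partial over the segment from \<open>z\<close> to \<open>x\<close>. It makes the increment of a
  coefficient divisible by \<open>x - z\<close> with a continuous quotient.\<close>

lemma smooth_hadamard:
  fixes f :: "real \<times> real \<Rightarrow> 'b::banach"
  assumes f: "smooth f"
  obtains h where "continuous_on UNIV h" "\<And>t. h (z, t) = partial1 f (z, t)"
    "\<And>x t. f (x, t) - f (z, t) = (x - z) *\<^sub>R h (x, t)"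
proof
  define h where "h = (\<lambda>p. integral (cbox 0 1) (\<lambda>s::real. partial1 f (z + (fst p - z) * s, snd p)))"
  have c: "continuous_on UNIV (partial1 f)"
    using f by (intro smooth_continuous smooth_partial1)
  show "continuous_on UNIV h"
    unfolding h_def
    by (intro integral_continuous_on_param)
      (auto simp: case_prod_unfold intro!: continuous_intros continuous_on_compose2[OF c])
  show "h (z, t) = partial1 f (z, t)" for t
    by (simp add: h_def)
  fix x t
  have *: "((\<lambda>r. f (z + r, t)) has_vector_derivative partial1 f (z + r, t)) (at r)" for r
    using has_vector_derivative_along_line[OF smooth_C_order[OF f], of z 1 t 0 r] by simp
  \<comment> \<open>The integration variable is the displacement from \<open>z\<close>, placed in
    the second slot because \<open>int2\<close> integrates there; the first slot is a dummy.\<close>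
  have "f (z + (x - z), t) = f (z + 0, t) + int2 (\<lambda>p. partial1 f (z + snd p, t)) (0, x - z)"
    using eq_int2I[of "\<lambda>p. f (z + snd p, t)" 0 "\<lambda>p. partial1 f (z + snd p, t)" "x - z"] *
    unfolding snd_conv .
  then show "f (x, t) - f (z, t) = (x - z) *\<^sub>R h (x, t)"
    by (simp add: int2_def h_def)
qed

section \<open>Complex matrices\<close>

lemma bounded_bilinear_matrix_mult:
  "bounded_bilinear ((**) :: complex^'n^'m \<Rightarrow> complex^'p^'n \<Rightarrow> complex^'p^'m)"
proof -
  have "bilinear ((**) :: complex^'n^'m \<Rightarrow> complex^'p^'n \<Rightarrow> complex^'p^'m)"
    unfolding bilinear_def
    by (auto intro!: linearI simp: matrix_matrix_mult_def vec_eq_iff sum.distrib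
      distrib_left distrib_right scaleR_sum_right)
  then show ?thesis
    by (simp add: bilinear_conv_bounded_bilinear)
qed

interpretation matrix_mult:
  bounded_bilinear "(**) :: complex^'n^'m \<Rightarrow> complex^'p^'n \<Rightarrow> complex^'p^'m"
  by (rule bounded_bilinear_matrix_mult)

lemmas matrix_mult_linear =
  matrix_mult.add_left matrix_mult.add_right matrix_mult.diff_left matrix_mult.diff_right
  matrix_mult.minus_left matrix_mult.minus_right matrix_mult.scaleR_left matrix_mult.scaleR_right

lemma conj_transpose_mult: "conj_transpose (A ** B) = conj_transpose B ** conj_transpose A"
  by (simp add: conj_transpose_def matrix_matrix_mult_def vec_eq_iff mult.commute)

lemma conj_transpose_conj_transpose [simp]: "conj_transpose (conj_transpose A) = A"
  by (simp add: conj_transpose_def vec_eq_iff)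

lemma conj_transpose_mat1 [simp]: "conj_transpose (mat 1) = mat 1"
  by (simp add: conj_transpose_def mat_def vec_eq_iff)

lemma conj_transpose_uminus: "conj_transpose (- A) = - conj_transpose A"
  by (simp add: conj_transpose_def vec_eq_iff)

lemma conj_transpose_add: "conj_transpose (A + B) = conj_transpose A + conj_transpose B"
  by (simp add: conj_transpose_def vec_eq_iff)

lemma conj_transpose_scaleR: "conj_transpose (c *\<^sub>R A) = c *\<^sub>R conj_transpose A"
  by (simp add: conj_transpose_def vec_eq_iff)

text \<open>Conjugate transposition is conjugate-linear over the complex numbers but linear over the
  reals, which is all that differentiation in real variables needs.\<close>

lemma bounded_linear_conj_transpose:
  "bounded_linear (conj_transpose :: complex^'n^'m \<Rightarrow> complex^'m^'n)"
  unfolding linear_conv_bounded_linear[symmetric]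
  by (intro linearI conj_transpose_add conj_transpose_scaleR)

lemma det_conj_transpose: "det (conj_transpose A) = cnj (det A)" for A :: "complex^'n^'n"
proof -
  have "det (conj_transpose A) = det (\<chi> i j. cnj (A $ i $ j))"
    by (subst det_transpose[symmetric]) (simp add: conj_transpose_def transpose_def)
  then show ?thesis
    by (simp add: det_def)
qed

lemma trace_scaleR: "trace (c *\<^sub>R A) = c *\<^sub>R trace A" for A :: "complex^'n^'n"
  by (simp add: trace_def scaleR_sum_right)

lemma trace_uminus: "trace (- A) = - trace A" for A :: "complex^'n^'n"
  by (simp add: trace_def sum_negf)

section \<open>The group SU(n) and its Lie algebra\<close>

lemma SU_cancel:
  assumes "U \<in> SU"
  shows "conj_transpose U ** U = mat 1" "U ** conj_transpose U = mat 1"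
    "X ** conj_transpose U ** U = X" "X ** U ** conj_transpose U = X"
  using assms by (simp_all add: SU_def flip: matrix_mul_assoc)

lemma SU_invertible: "U \<in> SU \<Longrightarrow> invertible U"
  using SU_cancel invertible_def by blast

text \<open>\<open>matrix_inv\<close> is a choice among two-sided inverses. For square matrices a
  one-sided inverse is two-sided, so the choice exists and is forced.\<close>

lemma matrix_inv_eqI:
  fixes A B :: "complex^'n^'n"
  assumes "A ** B = mat 1"
  shows "matrix_inv A = B"
proof -
  have "\<exists>A'. A ** A' = mat 1 \<and> A' ** A = mat 1"
    using assms matrix_left_right_inverse by blast
  then have "matrix_inv A ** A = mat 1"
    unfolding matrix_inv_def by (rule someI2_ex) simp
  then have "matrix_inv A ** A ** B = B"
    by simp
  then show ?thesis
    using assms by (simp flip: matrix_mul_assoc)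
qed

lemma SU_matrix_inv: "U \<in> SU \<Longrightarrow> matrix_inv U = conj_transpose U"
  using SU_cancel(2) by (rule matrix_inv_eqI)

lemma SU_conj_transpose: "U \<in> SU \<Longrightarrow> conj_transpose U \<in> SU"
  by (simp add: SU_def det_conj_transpose)

lemma SU_mult: "U \<in> SU \<Longrightarrow> V \<in> SU \<Longrightarrow> U ** V \<in> SU"
  using SU_cancel(3)[of U "conj_transpose V"] SU_cancel(4)[of V U]
  by (simp add: SU_def conj_transpose_mult det_mul matrix_mul_assoc)

lemma su_uminus: "A \<in> su \<Longrightarrow> - A \<in> su"
  by (simp add: su_def conj_transpose_uminus trace_uminus)

lemma su_add: "A \<in> su \<Longrightarrow> B \<in> su \<Longrightarrow> A + B \<in> su"
  by (simp add: su_def conj_transpose_add trace_add)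

lemma su_scaleR: "A \<in> su \<Longrightarrow> c *\<^sub>R A \<in> su" for A :: "complex^'n^'n"
  by (simp add: su_def conj_transpose_scaleR trace_scaleR)

lemma su_conjugate:
  assumes "U \<in> SU" "A \<in> su"
  shows "U ** A ** conj_transpose U \<in> su"
proof -
  have "trace (U ** A ** conj_transpose U) = trace A"
    using assms(1) by (simp add: trace_mul_sym[of "U ** A"] matrix_mul_assoc SU_cancel)
  then show ?thesis
    using assms
    by (simp add: su_def conj_transpose_mult matrix_mul_assoc matrix_mult_linear)
qed

section \<open>Derivative of the determinant, and logarithmic derivatives of curves in SU(n)\<close>

text \<open>In the Leibniz expansion only the identity permutation contributes to first order: any
  other one moves at least two points, so every term of the product rule keeps an off-diagonal entry
  of the identity matrix.\<close>

lemma has_vector_derivative_det_at_mat1: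
  fixes M :: "real \<Rightarrow> complex^'n^'n"
  assumes M: "(M has_vector_derivative D) (at t)" and 1: "M t = mat 1"
  shows "((\<lambda>t. det (M t)) has_vector_derivative trace D) (at t)"
proof -
  have entry: "((\<lambda>t. M t $ i $ j) has_derivative (\<lambda>h. h *\<^sub>R (D $ i $ j))) (at t)" for i j
  proof -
    have "bounded_linear (\<lambda>A::complex^'n^'n. A $ i $ j)"
      by (intro bounded_linear_compose[OF bounded_linear_vec_nth bounded_linear_vec_nth])
    from bounded_linear.has_vector_derivative[OF this M] show ?thesis
      by (simp add: has_vector_derivative_def)
  qed
  have term_deriv: "((\<lambda>t. of_int (sign p) * (\<Prod>i\<in>UNIV. M t $ i $ p i)) has_derivative
      (\<lambda>h. h *\<^sub>R (if p = id then trace D else 0))) (at t)"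
    if p: "p permutes UNIV" for p
  proof -
    have "((\<lambda>t. of_int (sign p) * (\<Prod>i\<in>UNIV. M t $ i $ p i)) has_derivative
        (\<lambda>h. of_int (sign p) *
          (\<Sum>i\<in>UNIV. h *\<^sub>R (D $ i $ p i) * (\<Prod>j\<in>UNIV - {i}. M t $ j $ p j)))) (at t)"
      by (intro has_derivative_mult_right has_derivative_prod entry)
    also have "(\<lambda>h. of_int (sign p) *
          (\<Sum>i\<in>UNIV. h *\<^sub>R (D $ i $ p i) * (\<Prod>j\<in>UNIV - {i}. M t $ j $ p j)))
        = (\<lambda>h. h *\<^sub>R (if p = id then trace D else 0))"
    proof (cases "p = id")
      case True
      then show ?thesis
        by (simp add: 1 mat_def sign_id trace_def scaleR_sum_right)
    next
      case False
      have vanish: "(\<Prod>j\<in>UNIV - {i}. M t $ j $ p j) = 0" for i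
      proof -
        obtain k where k: "p k \<noteq> k"
          using False by (auto simp: fun_eq_iff)
        \<comment> \<open>By injectivity \<open>p k\<close> is moved as well, so at least one of the
          moved points \<open>k\<close> and \<open>p k\<close> differs from
          \<open>i\<close>.\<close>
        then have "p (p k) \<noteq> p k"
          using permutes_inj[OF p] by (auto dest: injD)
        with k obtain j where "j \<noteq> i" "p j \<noteq> j"
          by metis
        then show ?thesis
          by (intro prod_zero bexI[of _ j]) (auto simp: 1 mat_def)
      qed
      show ?thesis
        using False unfolding vanish by simp
    qed
    finally show ?thesis .
  qed
  have "((\<lambda>t. \<Sum>p\<in>{p. p permutes UNIV}. of_int (sign p) * (\<Prod>i\<in>UNIV. M t $ i $ p i)) has_derivative
      (\<lambda>h. \<Sum>p\<in>{p. p permutes (UNIV::'n set)}. h *\<^sub>R (if p = id then trace D else 0))) (at t)"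
    by (intro has_derivative_sum term_deriv) simp
  moreover have "(\<Sum>p\<in>{p. p permutes (UNIV::'n set)}. h *\<^sub>R (if p = id then trace D else 0))
      = h *\<^sub>R trace D" for h :: real
    by (simp add: permutes_id finite_permutations flip: scaleR_sum_right)
  ultimately show ?thesis
    by (simp add: det_def has_vector_derivative_def)
qed

text \<open>Jacobi's formula. Multiplying by the constant inverse \<open>N\<close> of
  \<open>M t\<close> moves the base point to the identity, and multiplicativity of the determinant
  moves it back.\<close>

lemma has_vector_derivative_det:
  fixes M :: "real \<Rightarrow> complex^'n^'n"
  assumes M: "(M has_vector_derivative D) (at t)" and N: "N ** M t = mat 1"
  shows "((\<lambda>t. det (M t)) has_vector_derivative det (M t) * trace (N ** D)) (at t)"
proof -
  have inv: "M t ** N = mat 1"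
    using N matrix_left_right_inverse by blast
  have "((\<lambda>t. N ** M t) has_vector_derivative N ** D) (at t)"
    using bounded_linear.has_vector_derivative[OF matrix_mult.bounded_linear_right M] .
  from has_vector_derivative_mult_right[OF has_vector_derivative_det_at_mat1[OF this N], of "det (M t)"]
  have "((\<lambda>r. det (M t) * det (N ** M r)) has_vector_derivative det (M t) * trace (N ** D)) (at t)" .
  moreover have "det (M t) * det (N ** M r) = det (M r)" for r
    using inv by (simp add: matrix_mul_assoc flip: det_mul)
  ultimately show ?thesis
    by simp
qed

text \<open>Differentiating the constant product of \<open>M\<close> with its adjoint gives
  skewness; differentiating the constant determinant gives trace zero.\<close>

lemma SU_logarithmic_derivative:
  fixes M :: "real \<Rightarrow> complex^'n^'n"
  assumes M: "(M has_vector_derivative D) (at t)" and SU: "\<And>r. M r \<in> SU"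
  shows "conj_transpose (M t) ** D \<in> su"
proof -
  have "((\<lambda>r. conj_transpose (M r) ** M r) has_vector_derivative
      conj_transpose (M t) ** D + conj_transpose D ** M t) (at t)"
    by (intro matrix_mult.has_vector_derivative M
      bounded_linear.has_vector_derivative[OF bounded_linear_conj_transpose])
  then have "((\<lambda>r. mat 1 :: complex^'n^'n) has_vector_derivative
      conj_transpose (M t) ** D + conj_transpose D ** M t) (at t)"
    by (simp add: SU_cancel[OF SU])
  then have "conj_transpose (M t) ** D + conj_transpose D ** M t = 0"
    using has_vector_derivative_const vector_derivative_unique_at by blast
  then have skew: "conj_transpose D ** M t = - (conj_transpose (M t) ** D)"
    by (simp add: eq_neg_iff_add_eq_0 add.commute)
  have "((\<lambda>r. det (M r)) has_vector_derivative det (M t) * trace (conj_transpose (M t) ** D)) (at t)"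
    by (intro has_vector_derivative_det M SU_cancel SU)
  moreover have "det (M r) = 1" for r
    using SU[of r] by (simp add: SU_def)
  ultimately have "((\<lambda>r. 1) has_vector_derivative trace (conj_transpose (M t) ** D)) (at t)"
    by simp
  then have "trace (conj_transpose (M t) ** D) = 0"
    using has_vector_derivative_const vector_derivative_unique_at by blast
  then show ?thesis
    using skew by (simp add: su_def conj_transpose_mult)
qed

section \<open>Linear differential equations with a parameter\<close>

lemma int2_diff:
  assumes f: "continuous_on UNIV f" and g: "continuous_on UNIV g"
  shows "int2 (\<lambda>p. f p - g p) q = int2 f q - int2 g q"
proof -
  have "(\<lambda>s. f (fst q, snd q * s)) integrable_on cbox 0 1"
    by (intro integrable_continuous continuous_on_compose2[OF f] continuous_intros) auto
  moreover have "(\<lambda>s. g (fst q, snd q * s)) integrable_on cbox 0 1"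
    by (intro integrable_continuous continuous_on_compose2[OF g] continuous_intros) auto
  ultimately show ?thesis
    unfolding int2_def by (simp only: integral_diff scaleR_diff_right)
qed

text \<open>The iterated integrals of the Peano-Baker series. New factors \<open>A\<close> enter on
  the right, in accordance with \<open>Y\<^sub>y = Y A\<close>.\<close>

primrec picard_term :: "(real \<times> real \<Rightarrow> complex^'n^'n) \<Rightarrow> nat \<Rightarrow> real \<times> real \<Rightarrow> complex^'n^'n" where
  "picard_term A 0 = (\<lambda>p. mat 1)"
| "picard_term A (Suc n) = int2 (\<lambda>p. picard_term A n p ** A p)"

lemma continuous_picard_term:
  assumes "continuous_on UNIV A"
  shows "continuous_on UNIV (picard_term A n)"
proof (induction n)
  case (Suc n)
  then show ?case
    using assms by (auto intro!: continuous_int2 matrix_mult.continuous_on)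
qed simp

text \<open>\<open>K\<close> is a bound for the bilinear matrix product. Each step multiplies by at
  most \<open>K * a\<close> and integrates once, so the majorants are the terms of an exponential
  series.\<close>

lemma picard_term_norm_le:
  fixes A :: "real \<times> real \<Rightarrow> complex^'n^'n"
  assumes A: "continuous_on UNIV A"
    and K: "0 \<le> K" "\<And>(X :: complex^'n^'n) (Y :: complex^'n^'n). norm (X ** Y) \<le> norm X * norm Y * K"
    and a: "\<And>x y. \<bar>x\<bar> \<le> R \<Longrightarrow> \<bar>y\<bar> \<le> R \<Longrightarrow> norm (A (x, y)) \<le> a"
    and x: "\<bar>x\<bar> \<le> R"
  shows "\<bar>y\<bar> \<le> R \<Longrightarrow> norm (picard_term A n (x, y))
    \<le> norm (mat 1 :: complex^'n^'n) * (K * a * \<bar>y\<bar>) ^ n / fact n"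
proof (induction n arbitrary: y)
  case (Suc n)
  let ?c = "norm (mat 1 :: complex^'n^'n)"
  have "norm (picard_term A n (x, t) ** A (x, t)) \<le> ?c * (K * a) ^ Suc n / fact n * \<bar>t\<bar> ^ n"
    if t: "\<bar>t\<bar> \<le> \<bar>y\<bar>" for t
  proof -
    have tR: "\<bar>t\<bar> \<le> R"
      using t Suc.prems by linarith
    have "norm (picard_term A n (x, t) ** A (x, t))
        \<le> norm (picard_term A n (x, t)) * norm (A (x, t)) * K"
      by (rule K(2))
    also have "\<dots> \<le> (?c * (K * a * \<bar>t\<bar>) ^ n / fact n) * a * K"
    proof (intro mult_right_mono mult_mono)
      show "0 \<le> ?c * (K * a * \<bar>t\<bar>) ^ n / fact n"
        using Suc.IH[OF tR] norm_ge_zero order_trans by blast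
    qed (use Suc.IH[OF tR] a[OF x tR] K(1) in auto)
    finally show ?thesis
      by (simp add: power_mult_distrib mult_ac)
  qed
  then have "norm (picard_term A (Suc n) (x, y))
      \<le> ?c * (K * a) ^ Suc n / fact n * \<bar>y\<bar> ^ Suc n / Suc n"
    unfolding picard_term.simps
    using A by (intro int2_norm_le matrix_mult.continuous_on continuous_picard_term)
  also have "\<dots> = ?c * (K * a * \<bar>y\<bar>) ^ Suc n / fact (Suc n)"
    by (simp add: power_mult_distrib mult_ac)
  finally show ?case .
qed simp

text \<open>The M-test gives uniform convergence on every square centred at the origin, hence a
  continuous limit on the whole plane. The limit inherits the integral equation from the partial
  sums, and differentiating that equation gives the claim.\<close>

lemma linear_ode_exists:
  fixes A :: "real \<times> real \<Rightarrow> complex^'n^'n"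
  assumes A: "continuous_on UNIV A"
  obtains Y where "continuous_on UNIV Y" "\<And>x. Y (x, 0) = mat 1"
    "\<And>x y. ((\<lambda>t. Y (x, t)) has_vector_derivative Y (x, y) ** A (x, y)) (at y)"
proof
  define Y where "Y = (\<lambda>p. \<Sum>i. picard_term A i p)"
  define P where "P = (\<lambda>n p. \<Sum>i<n. picard_term A i p)"
  obtain K where K: "0 \<le> K" "\<And>(X :: complex^'n^'n) (Y :: complex^'n^'n). norm (X ** Y) \<le> norm X * norm Y * K"
    using matrix_mult.nonneg_bounded by blast
  have contP: "continuous_on UNIV (P n)" for n
    unfolding P_def by (intro continuous_on_sum continuous_picard_term A)
  have bound: "\<exists>a\<ge>0. \<forall>x y. \<bar>x\<bar> \<le> R \<longrightarrow> \<bar>y\<bar> \<le> R \<longrightarrow> norm (A (x, y)) \<le> a" for R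
  proof -
    have "compact (A ` cbox (- R, - R) (R, R))"
      by (intro compact_continuous_image compact_cbox continuous_on_subset[OF A]) auto
    then obtain a where "\<forall>z \<in> A ` cbox (- R, - R) (R, R). norm z \<le> a"
      using bounded_iff compact_imp_bounded by blast
    then have "norm (A (x, y)) \<le> a" if "\<bar>x\<bar> \<le> R" "\<bar>y\<bar> \<le> R" for x y
      using that by (force simp: cbox_Pair_eq abs_le_iff)
    then show ?thesis
      by (intro exI[of _ "max a 0"]) (auto simp: le_max_iff_disj)
  qed
  have lim: "uniform_limit (cbox (- R, - R) (R, R)) P Y sequentially" if R: "0 \<le> R" for R
  proof -
    obtain a where a: "0 \<le> a" "\<And>x y. \<bar>x\<bar> \<le> R \<Longrightarrow> \<bar>y\<bar> \<le> R \<Longrightarrow> norm (A (x, y)) \<le> a"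
      using bound by blast
    let ?M = "\<lambda>n. norm (mat 1 :: complex^'n^'n) * ((K * a * R) ^ n / fact n)"
    have "summable (\<lambda>n. (K * a * R) ^ n / fact n)"
      using summable_exp[of "K * a * R"] by (simp add: field_simps)
    then have "summable ?M"
      by (rule summable_mult)
    moreover have "norm (picard_term A n p) \<le> ?M n" if "p \<in> cbox (- R, - R) (R, R)" for n p
    proof -
      obtain x y where p: "p = (x, y)"
        by (cases p)
      have xy: "\<bar>x\<bar> \<le> R" "\<bar>y\<bar> \<le> R"
        using that unfolding p by (auto simp: cbox_Pair_eq abs_le_iff)
      have "norm (picard_term A n p) \<le> norm (mat 1 :: complex^'n^'n) * (K * a * \<bar>y\<bar>) ^ n / fact n"
        unfolding p using picard_term_norm_le[OF A K a(2) xy] by simp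
      also have "\<dots> \<le> norm (mat 1 :: complex^'n^'n) * (K * a * R) ^ n / fact n"
        using xy a K by (intro divide_right_mono mult_left_mono power_mono) auto
      finally show ?thesis by simp
    qed
    ultimately show ?thesis
      unfolding P_def Y_def by (intro Weierstrass_m_test)
  qed
  have inbox: "(x, y) \<in> cbox (- (\<bar>x\<bar> + \<bar>y\<bar>), - (\<bar>x\<bar> + \<bar>y\<bar>)) (\<bar>x\<bar> + \<bar>y\<bar>, \<bar>x\<bar> + \<bar>y\<bar>)" for x y :: real
    by (auto simp: cbox_Pair_eq)
  show contY: "continuous_on UNIV Y"
  proof -
    have "isCont Y (x, y)" for x y
    proof -
      \<comment> \<open>The margin 1 makes \<open>(x, y)\<close> interior, so continuity on the
        square gives continuity at the point.\<close>
      define R where "R = \<bar>x\<bar> + \<bar>y\<bar> + 1"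
      have "continuous_on (cbox (- R, - R) (R, R)) Y"
        using contP by (intro uniform_limit_theorem[OF _ lim])
          (auto simp: R_def intro!: always_eventually continuous_on_subset[OF contP])
      moreover have "(x, y) \<in> interior (cbox (- R, - R) (R, R))"
        by (auto simp: interior_cbox mem_box Basis_prod_def R_def)
      ultimately show ?thesis
        by (rule continuous_on_interior)
    qed
    then show ?thesis
      by (auto intro: continuous_at_imp_continuous_on)
  qed
  have contYA: "continuous_on UNIV (\<lambda>p. Y p ** A p)"
    by (intro matrix_mult.continuous_on contY A)
  have contPA: "continuous_on UNIV (\<lambda>p. P n p ** A p)" for n
    by (intro matrix_mult.continuous_on contP A)
  \<comment> \<open>The initial term is constant and every later one is the integral of its
    predecessor times \<open>A\<close>; hence the index drops by one.\<close>
  have P_deriv: "((\<lambda>t. P (Suc n) (x, t)) has_vector_derivative P n (x, y) ** A (x, y)) (at y)" for n x y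
  proof -
    have "((\<lambda>t. mat 1 + (\<Sum>i<n. picard_term A (Suc i) (x, t))) has_vector_derivative
        0 + (\<Sum>i<n. picard_term A i (x, y) ** A (x, y))) (at y)"
      unfolding picard_term.simps
      by (intro has_vector_derivative_add has_vector_derivative_sum int2_has_partial2
        has_vector_derivative_const matrix_mult.continuous_on continuous_picard_term A)
    then show ?thesis
      unfolding P_def matrix_mult.sum_left sum.lessThan_Suc_shift by simp
  qed
  have P_eq: "P (Suc n) (x, y) = mat 1 + int2 (\<lambda>p. P n p ** A p) (x, y)" for n x y
  proof -
    have "P (Suc n) (x, 0) = mat 1"
      unfolding P_def sum.lessThan_Suc_shift by simp
    then show ?thesis
      using eq_int2I[where F = "P (Suc n)" and f = "\<lambda>p. P n p ** A p" and x = x and y = y,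
        OF P_deriv] by (simp only:)
  qed
  have Y_eq: "Y (x, y) = mat 1 + int2 (\<lambda>p. Y p ** A p) (x, y)" for x y
  proof (rule LIMSEQ_unique)
    let ?R = "\<bar>x\<bar> + \<bar>y\<bar>"
    show "(\<lambda>n. P (Suc n) (x, y)) \<longlonglongrightarrow> Y (x, y)"
      using tendsto_uniform_limitI[OF lim inbox] by (intro LIMSEQ_Suc) auto
    obtain a where a: "0 \<le> a" "\<And>x y. \<bar>x\<bar> \<le> ?R \<Longrightarrow> \<bar>y\<bar> \<le> ?R \<Longrightarrow> norm (A (x, y)) \<le> a"
      using bound by blast
    have "(\<lambda>n. int2 (\<lambda>p. P n p ** A p) (x, y)) \<longlonglongrightarrow> int2 (\<lambda>p. Y p ** A p) (x, y)"
    proof (rule tendstoI)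
      fix e :: real assume e: "0 < e"
      \<comment> \<open>The summand 1 keeps the denominator positive when \<open>a\<close>,
        \<open>K\<close> or \<open>y\<close> vanishes and makes the final estimate strict.\<close>
      define d where "d = e / (a * K * \<bar>y\<bar> + 1)"
      have pos: "0 < a * K * \<bar>y\<bar> + 1"
        using a(1) K(1) by (intro add_nonneg_pos) auto
      then have d: "0 < d"
        using e by (simp add: d_def)
      have "d * a * K * \<bar>y\<bar> < e"
        using pos e by (simp add: d_def field_simps)
      note less = this
      have "\<forall>\<^sub>F n in sequentially. \<forall>p \<in> cbox (- ?R, - ?R) (?R, ?R). dist (P n p) (Y p) < d"
        using lim[of ?R] d by (auto simp: uniform_limit_iff)
      then show "\<forall>\<^sub>F n in sequentially.
          dist (int2 (\<lambda>p. P n p ** A p) (x, y)) (int2 (\<lambda>p. Y p ** A p) (x, y)) < e"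
      proof eventually_elim
        case (elim n)
        \<comment> \<open>The power with exponent 0 gives the uniform bound the form that
          \<open>int2_norm_le\<close> expects.\<close>
        have "norm ((P n (x, t) - Y (x, t)) ** A (x, t)) \<le> d * a * K * \<bar>t\<bar> ^ 0" if "\<bar>t\<bar> \<le> \<bar>y\<bar>" for t
        proof -
          have "(x, t) \<in> cbox (- ?R, - ?R) (?R, ?R)"
            using that by (auto simp: cbox_Pair_eq)
          then have "norm (P n (x, t) - Y (x, t)) \<le> d"
            using elim by (auto simp: dist_norm less_imp_le)
          moreover have "norm (A (x, t)) \<le> a"
            using that by (intro a) auto
          ultimately have "norm (P n (x, t) - Y (x, t)) * norm (A (x, t)) * K \<le> d * a * K"
            using K d by (intro mult_right_mono mult_mono) auto
          then show ?thesis
            using K(2) order_trans by fastforce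
        qed
        then have "norm (int2 (\<lambda>p. (P n p - Y p) ** A p) (x, y)) \<le> d * a * K * \<bar>y\<bar> ^ Suc 0 / Suc 0"
          by (intro int2_norm_le matrix_mult.continuous_on continuous_on_diff contP contY A)
        then show ?case
          using less int2_diff[OF contPA contYA]
          by (simp add: dist_norm matrix_mult.diff_left)
      qed
    qed
    then show "(\<lambda>n. P (Suc n) (x, y)) \<longlonglongrightarrow> mat 1 + int2 (\<lambda>p. Y p ** A p) (x, y)"
      unfolding P_eq by (intro tendsto_intros)
  qed
  show "Y (x, 0) = mat 1" for x
    using Y_eq[of x 0] by simp
  show "((\<lambda>t. Y (x, t)) has_vector_derivative Y (x, y) ** A (x, y)) (at y)" for x y
  proof -
    have "((\<lambda>t. mat 1 + int2 (\<lambda>p. Y p ** A p) (x, t)) has_vector_derivative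
        0 + Y (x, y) ** A (x, y)) (at y)"
      by (intro has_vector_derivative_add has_vector_derivative_const int2_has_partial2 contYA)
    then show ?thesis
      by (simp flip: Y_eq)
  qed
qed

section \<open>Uniqueness for skew coefficients, and smooth dependence on the parameter\<close>

text \<open>The difference quotient at \<open>z\<close> is \<open>c x\<close> itself, so continuity
  of \<open>c\<close> takes the place of the product rule.\<close>

lemma has_vector_derivative_scaleR_vanishing:
  fixes c :: "real \<Rightarrow> 'b::real_normed_vector"
  assumes c: "isCont c z"
  shows "((\<lambda>x. (x - z) *\<^sub>R c x) has_vector_derivative c z) (at z)"
  unfolding has_vector_derivative_def has_derivative_iff_norm
proof
  have "((\<lambda>x. norm (c x - c z)) \<longlongrightarrow> 0) (at z)"
    using c by (simp add: isCont_def tendsto_norm_zero_iff LIM_zero_iff)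
  moreover have "\<forall>\<^sub>F x in at z. norm (c x - c z)
      = norm ((x - z) *\<^sub>R c x - (z - z) *\<^sub>R c z - (x - z) *\<^sub>R c z) / norm (x - z)"
    by (auto simp: eventually_at_filter simp flip: scaleR_diff_right)
  ultimately show "((\<lambda>x. norm ((x - z) *\<^sub>R c x - (z - z) *\<^sub>R c z - (x - z) *\<^sub>R c z) / norm (x - z))
      \<longlongrightarrow> 0) (at z)"
    by (rule Lim_transform_eventually)
qed (rule bounded_linear_scaleR_left)

lemma constant_if_zero_vector_derivative:
  fixes f :: "real \<Rightarrow> 'b::real_normed_vector"
  assumes "\<And>t. (f has_vector_derivative 0) (at t)"
  shows "f x = f y"
  using assms by (intro has_derivative_zero_unique[of UNIV f]) (auto simp: has_vector_derivative_def)

text \<open>Skewness of \<open>B\<close> makes the adjoint of \<open>V\<close> satisfy the equation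
  with \<open>- B\<close> on the left, so the derivative is again a matrix between \<open>U\<close>
  and that adjoint. With \<open>X\<close> the identity this compares two solutions; with
  \<open>U = V\<close> it differentiates a conjugate of \<open>X\<close>.\<close>

lemma has_vector_derivative_mult_conj_transpose:
  fixes U V :: "real \<Rightarrow> complex^'n^'n"
  assumes "(U has_vector_derivative U t ** A) (at t)" "(V has_vector_derivative V t ** B) (at t)"
    and "(X has_vector_derivative X') (at t)" "conj_transpose B = - B"
  shows "((\<lambda>t. U t ** X t ** conj_transpose (V t)) has_vector_derivative
    U t ** (A ** X t - X t ** B + X') ** conj_transpose (V t)) (at t)"
proof -
  have "((\<lambda>t. U t ** X t ** conj_transpose (V t)) has_vector_derivative
      U t ** X t ** conj_transpose (V t ** B) + (U t ** X' + U t ** A ** X t) ** conj_transpose (V t)) (at t)"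
    by (intro matrix_mult.has_vector_derivative assms
      bounded_linear.has_vector_derivative[OF bounded_linear_conj_transpose])
  then show ?thesis
    using assms(4)
    by (simp add: conj_transpose_mult matrix_mult_linear matrix_mul_assoc algebra_simps)
qed

text \<open>With \<open>X\<close> the identity the two coefficient terms cancel. For
  \<open>U = V\<close> this yields unitarity; for a unitary \<open>V\<close> it shows that
  \<open>U\<close> is determined by its value at one point.\<close>

lemma skew_ode_constant:
  fixes U V :: "real \<Rightarrow> complex^'n^'n"
  assumes "\<And>t. (U has_vector_derivative U t ** B t) (at t)"
    and "\<And>t. (V has_vector_derivative V t ** B t) (at t)"
    and "\<And>t. conj_transpose (B t) = - B t"
  shows "U t ** conj_transpose (V t) = U r ** conj_transpose (V r)"
  using has_vector_derivative_mult_conj_transpose[OF assms(1,2) has_vector_derivative_const assms(3),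
      of "mat 1"]
  by (intro constant_if_zero_vector_derivative) simp

text \<open>Only continuity of \<open>Y\<close> in the parameter is known, so the equation cannot
  simply be differentiated in \<open>x\<close>. Instead the solutions at \<open>x\<close> and
  \<open>z\<close> are compared: the product of one with the adjoint of the other differs from the
  identity by an integral of \<open>A (x, t) - A (z, t)\<close>, from which Hadamard's lemma
  extracts the factor \<open>x - z\<close>.\<close>

lemma su_ode_partial1:
  fixes A Y :: "real \<times> real \<Rightarrow> complex^'n^'n"
  assumes A: "smooth A" "\<And>p. A p \<in> su"
    and Y: "continuous_on UNIV Y" "\<And>x. Y (x, 0) = mat 1" "\<And>p. Y p \<in> SU"
      "\<And>x y. ((\<lambda>t. Y (x, t)) has_vector_derivative Y (x, y) ** A (x, y)) (at y)"
  shows "((\<lambda>t. Y (t, y)) has_vector_derivative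
    int2 (\<lambda>p. Y p ** partial1 A p ** conj_transpose (Y p)) (z, y) ** Y (z, y)) (at z)"
proof -
  obtain h where h: "continuous_on UNIV h" "\<And>t. h (z, t) = partial1 A (z, t)"
    "\<And>x t. A (x, t) - A (z, t) = (x - z) *\<^sub>R h (x, t)"
    using smooth_hadamard[OF A(1)] by blast
  \<comment> \<open>At first coordinate \<open>z\<close> this is the integrand of the claimed
    derivative.\<close>
  define g where "g = (\<lambda>p. Y p ** h p ** conj_transpose (Y (z, snd p)))"
  have contg: "continuous_on UNIV g"
    unfolding g_def
    by (intro matrix_mult.continuous_on Y h continuous_intros
      bounded_linear.continuous_on[OF bounded_linear_conj_transpose]
      continuous_on_compose2[OF Y(1)]) auto
  have "Y (x, y) ** conj_transpose (Y (z, y)) = mat 1 + (x - z) *\<^sub>R int2 g (x, y)" for x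
  proof -
    let ?F = "\<lambda>p. Y p ** mat 1 ** conj_transpose (Y (z, snd p))"
    have "((\<lambda>t. ?F (x, t)) has_vector_derivative (fst (x, t) - z) *\<^sub>R g (x, t)) (at t)" for t
    proof -
      have "conj_transpose (A (z, t)) = - A (z, t)"
        using A(2) by (simp add: su_def)
      from has_vector_derivative_mult_conj_transpose[OF Y(4) Y(4) has_vector_derivative_const this,
          of x "mat 1"]
      show ?thesis
        by (simp add: h(3) g_def matrix_mult_linear)
    qed
    then have "?F (x, y) = ?F (x, 0) + int2 (\<lambda>p. (fst p - z) *\<^sub>R g p) (x, y)"
      by (rule eq_int2I)
    then show ?thesis
      by (simp add: Y(2) int2_def scaleR_left_commute)
  qed
  then have eq: "Y (x, y) = (mat 1 + (x - z) *\<^sub>R int2 g (x, y)) ** Y (z, y)" for x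
    using SU_cancel(3)[OF Y(3)] by metis
  have "isCont (\<lambda>x. int2 g (x, y)) z"
  proof -
    have "continuous_on UNIV (\<lambda>x. int2 g (x, y))"
      by (intro continuous_on_compose2[OF continuous_int2[OF contg]] continuous_intros) auto
    then show ?thesis
      by (simp add: continuous_on_eq_continuous_at)
  qed
  then have "((\<lambda>x. (mat 1 + (x - z) *\<^sub>R int2 g (x, y)) ** Y (z, y)) has_vector_derivative
      (0 + int2 g (z, y)) ** Y (z, y)) (at z)"
    by (intro bounded_linear.has_vector_derivative[OF matrix_mult.bounded_linear_left]
      has_vector_derivative_add has_vector_derivative_const has_vector_derivative_scaleR_vanishing)
  moreover have "int2 g (z, y) = int2 (\<lambda>p. Y p ** partial1 A p ** conj_transpose (Y p)) (z, y)"
    by (rule int2_cong) (simp add: g_def h(2))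
  ultimately show ?thesis
    by (simp flip: eq)
qed

text \<open>Skewness of \<open>A\<close> keeps the solution unitary and trace zero keeps its
  determinant at 1. Smoothness is a bootstrap through the formula for the first partial.\<close>

lemma su_ode_exists:
  fixes A :: "real \<times> real \<Rightarrow> complex^'n^'n"
  assumes A: "smooth A" "\<And>p. A p \<in> su"
  obtains Y where "smooth Y" "\<And>p. Y p \<in> SU" "\<And>x. Y (x, 0) = mat 1"
    "\<And>x y. ((\<lambda>t. Y (x, t)) has_vector_derivative Y (x, y) ** A (x, y)) (at y)"
proof -
  obtain Y where Y: "continuous_on UNIV Y" "\<And>x. Y (x, 0) = mat 1"
    "\<And>x y. ((\<lambda>t. Y (x, t)) has_vector_derivative Y (x, y) ** A (x, y)) (at y)"
    using linear_ode_exists[OF smooth_continuous[OF A(1)]] by blast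
  have skew: "conj_transpose (A p) = - A p" and trace: "trace (A p) = 0" for p
    using A(2)[of p] by (simp_all add: su_def)
  have unitary: "Y (x, y) ** conj_transpose (Y (x, y)) = mat 1" for x y
    using skew_ode_constant[OF Y(3) Y(3) skew, of x y 0] Y(2) by simp
  then have unitary': "conj_transpose (Y (x, y)) ** Y (x, y) = mat 1" for x y
    using matrix_left_right_inverse by blast
  have "((\<lambda>t. det (Y (x, t))) has_vector_derivative 0) (at y)" for x y
    using has_vector_derivative_det[OF Y(3) unitary', of x y]
    by (simp add: matrix_mul_assoc unitary' trace)
  then have "det (Y (x, y)) = det (Y (x, 0))" for x y
    by (rule constant_if_zero_vector_derivative)
  then have SU: "Y p \<in> SU" for p
    using unitary unitary' Y(2) by (cases p) (simp add: SU_def)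
  have "C_order k Y" for k
  proof (induction k)
    case 0
    then show ?case using Y(1) by simp
  next
    case (Suc k)
    show ?case
    \<comment> \<open>Both partials are built from \<open>Y\<close>, \<open>A\<close> and the first
      partial of \<open>A\<close> by products, adjoints and \<open>int2\<close>, all of which
      preserve order \<open>k\<close>.\<close>
    proof (rule C_order_SucI)
      show "((\<lambda>t. Y (t, y)) has_vector_derivative
        (\<lambda>p. int2 (\<lambda>p. Y p ** partial1 A p ** conj_transpose (Y p)) p ** Y p) (x, y)) (at x)" for x y
        using su_ode_partial1[OF A Y(1,2) SU Y(3)] by simp
      show "((\<lambda>t. Y (x, t)) has_vector_derivative (\<lambda>p. Y p ** A p) (x, y)) (at y)" for x y
        using Y(3) by simp
      show "C_order k (\<lambda>p. int2 (\<lambda>p. Y p ** partial1 A p ** conj_transpose (Y p)) p ** Y p)"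
        by (intro C_order_bounded_bilinear[OF bounded_bilinear_matrix_mult] C_order_int2
          C_order_bounded_linear[OF bounded_linear_conj_transpose] Suc smooth_C_order
          smooth_partial1 A)
      show "C_order k (\<lambda>p. Y p ** A p)"
        by (intro C_order_bounded_bilinear[OF bounded_bilinear_matrix_mult] Suc smooth_C_order A)
    qed
  qed
  then have "smooth Y"
    by (simp add: smooth_def)
  with SU Y that show thesis
    by blast
qed

section \<open>Flat connections\<close>

lemma smooth_mult:
  fixes X Y :: "real \<times> real \<Rightarrow> complex^'n^'n"
  shows "smooth X \<Longrightarrow> smooth Y \<Longrightarrow> smooth (\<lambda>p. X p ** Y p)"
  by (rule smooth_bounded_bilinear[OF bounded_bilinear_matrix_mult])

lemma smooth_conj_transpose:
  fixes X :: "real \<times> real \<Rightarrow> complex^'n^'n"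
  shows "smooth X \<Longrightarrow> smooth (\<lambda>p. conj_transpose (X p))"
  by (rule smooth_bounded_linear[OF bounded_linear_conj_transpose])

text \<open>Evaluates the definite description. A competitor \<open>G\<close>, not known to be
  unitary, is compared with \<open>E\<close> along the vertical line down to \<eta> = 0 and then
  along that axis to the origin.\<close>

lemma trivialization_eqI:
  fixes A B E :: "real \<times> real \<Rightarrow> complex^'n^'n"
  assumes E: "is_trivialization A B E" "\<And>p. E p \<in> SU"
    and su: "\<And>p. A p \<in> su" "\<And>p. B p \<in> su"
  shows "trivialization A B = E"
  unfolding trivialization_def
proof (rule the_equality[of "is_trivialization A B", OF E(1)])
  fix G assume G: "is_trivialization A B G"
  show "G = E"
  proof
    fix p :: "real \<times> real"
    obtain x y where p: "p = (x, y)"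
      by (cases p)
    have "G (x, y) ** conj_transpose (E (x, y)) = G (x, 0) ** conj_transpose (E (x, 0))"
      using E(1) G su(2)
      by (intro skew_ode_constant[where U = "\<lambda>t. G (x, t)" and V = "\<lambda>t. E (x, t)"
            and B = "\<lambda>t. B (x, t)"]) (auto simp: is_trivialization_def su_def)
    also have "\<dots> = G (0, 0) ** conj_transpose (E (0, 0))"
      using E(1) G su(1)
      by (intro skew_ode_constant[where U = "\<lambda>t. G (t, 0)" and V = "\<lambda>t. E (t, 0)"
            and B = "\<lambda>t. A (t, 0)"]) (auto simp: is_trivialization_def su_def)
    also have "\<dots> = mat 1"
      using E(1) G by (simp add: is_trivialization_def)
    finally show "G p = E p"
      using SU_cancel(3)[OF E(2), of "G p" p] by (simp add: p)
  qed
qed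

text \<open>Integrate first along the axis \<eta> = 0 and then in \<eta>. The \<eta>-equation holds
  by construction and the \<xi>-equation holds on the axis; flatness makes the defect of the latter
  solve a homogeneous linear equation in \<eta>, so it stays zero.\<close>

lemma flat_trivialization_exists:
  fixes A B :: "real \<times> real \<Rightarrow> complex^'n^'n"
  assumes A: "smooth A" "\<And>p. A p \<in> su" and B: "smooth B" "\<And>p. B p \<in> su"
    and flat: "\<And>p. partial2 A p - partial1 B p = commutator (A p) (B p)"
  obtains E where "smooth E" "\<And>p. E p \<in> SU" "is_trivialization A B E"
proof -
  obtain Y where Y: "smooth Y" "\<And>p. Y p \<in> SU" "\<And>x. Y (x, 0) = mat 1"
    "\<And>x y. ((\<lambda>t. Y (x, t)) has_vector_derivative Y (x, y) ** B (x, y)) (at y)"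
    using su_ode_exists[OF B] by blast
  \<comment> \<open>\<open>su_ode_exists\<close> integrates in the second variable, so that slot
    carries \<xi> here and the first is a dummy, set to 0 in \<open>E\<close>.\<close>
  have "smooth (\<lambda>p. A (snd p, 0))"
    using smooth_linear_substitution[OF A(1), of 0 1 0 0] by simp
  then obtain W where W: "smooth W" "\<And>p. W p \<in> SU" "\<And>x. W (x, 0) = mat 1"
    "\<And>x y. ((\<lambda>t. W (x, t)) has_vector_derivative W (x, y) ** A (y, 0)) (at y)"
    using su_ode_exists[of "\<lambda>p. A (snd p, 0)"] A(2) by auto
  define E where "E = (\<lambda>p. W (0, fst p) ** Y p)"
  have E: "smooth E"
    unfolding E_def
    using smooth_linear_substitution[OF W(1), of 0 0 1 0] by (intro smooth_mult Y) simp
  have SU: "E p \<in> SU" for p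
    unfolding E_def by (intro SU_mult W Y)
  have E2: "((\<lambda>t. E (x, t)) has_vector_derivative E (x, y) ** B (x, y)) (at y)" for x y
    unfolding E_def
    using bounded_linear.has_vector_derivative[OF matrix_mult.bounded_linear_right Y(4)]
    by (simp add: matrix_mul_assoc)
  have partial2_E: "partial2 E = (\<lambda>p. E p ** B p)"
    using partial2_eqI[OF E2] by (simp add: fun_eq_iff)
  define D where "D = (\<lambda>p. partial1 E p - E p ** A p)"
  have D0: "D (x, 0) = 0" for x
  proof -
    have "partial1 E (x, 0) = W (0, x) ** A (x, 0)"
      using W(4) by (intro partial1_eqI) (simp add: E_def Y(3))
    then show ?thesis
      by (simp add: D_def E_def Y(3))
  qed
  have D2: "((\<lambda>t. D (x, t)) has_vector_derivative D (x, y) ** B (x, y)) (at y)" for x y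
  proof -
    \<comment> \<open>Symmetry of the mixed partials makes this also the \<eta>-derivative of the
      first partial of \<open>E\<close>.\<close>
    have "partial1 (partial2 E) (x, y) = E (x, y) ** partial1 B (x, y) + partial1 E (x, y) ** B (x, y)"
      unfolding partial2_E
      by (intro partial1_eqI matrix_mult.has_vector_derivative smooth_has_partial1 E B)
    then have "((\<lambda>t. partial1 E (x, t)) has_vector_derivative
        E (x, y) ** partial1 B (x, y) + partial1 E (x, y) ** B (x, y)) (at y)"
      using smooth_has_partial2[OF smooth_partial1[OF E], of x y]
      by (simp add: smooth_mixed_partials[OF E])
    moreover have "((\<lambda>t. E (x, t) ** A (x, t)) has_vector_derivative
        E (x, y) ** partial2 A (x, y) + E (x, y) ** B (x, y) ** A (x, y)) (at y)"
      by (intro matrix_mult.has_vector_derivative E2 smooth_has_partial2 A)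
    ultimately have "((\<lambda>t. D (x, t)) has_vector_derivative
        E (x, y) ** partial1 B (x, y) + partial1 E (x, y) ** B (x, y)
        - (E (x, y) ** partial2 A (x, y) + E (x, y) ** B (x, y) ** A (x, y))) (at y)"
      unfolding D_def by (rule has_vector_derivative_diff)
    moreover have "partial2 A (x, y) = partial1 B (x, y) + commutator (A (x, y)) (B (x, y))"
      using flat[of "(x, y)"] by (simp add: algebra_simps)
    ultimately show ?thesis
      by (simp add: D_def commutator_def matrix_mult_linear matrix_mul_assoc algebra_simps)
  qed
  have D: "D (x, y) = 0" for x y
  proof -
    \<comment> \<open>\<open>D\<close> and \<open>Y\<close> solve the same equation in \<eta>, so
      their comparison product keeps its value 0 from the axis.\<close>
    have "D (x, y) ** conj_transpose (Y (x, y)) = D (x, 0) ** conj_transpose (Y (x, 0))"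
      using B(2) by (intro skew_ode_constant[where U = "\<lambda>t. D (x, t)", OF D2 Y(4)])
        (simp add: su_def)
    then show ?thesis
      using SU_cancel(3)[OF Y(2), of "D (x, y)" "(x, y)"] by (simp add: D0)
  qed
  have "((\<lambda>t. E (t, y)) has_vector_derivative E (x, y) ** A (x, y)) (at x)" for x y
    using smooth_has_partial1[OF E, of y x] D[of x y] by (simp add: D_def)
  moreover have "E (0, 0) = mat 1"
    by (simp add: E_def W(3) Y(3))
  ultimately have "is_trivialization A B E"
    unfolding is_trivialization_def using E2 SU_invertible[OF SU] by simp
  with E SU that show thesis
    by blast
qed

text \<open>Equate the two mixed partials of \<open>E\<close>, computed from its two first-order
  equations, and cancel \<open>E\<close>.\<close>

lemma flat_if_trivialization:
  fixes A B E :: "real \<times> real \<Rightarrow> complex^'n^'n"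
  assumes E: "is_trivialization A B E" "smooth E" "\<And>p. E p \<in> SU"
    and A: "smooth A" and B: "smooth B"
  shows "partial2 A p - partial1 B p = commutator (A p) (B p)"
proof -
  obtain x y where p: "p = (x, y)"
    by (cases p)
  have d: "((\<lambda>t. E (t, y)) has_vector_derivative E (x, y) ** A (x, y)) (at x)"
    "((\<lambda>t. E (x, t)) has_vector_derivative E (x, y) ** B (x, y)) (at y)" for x y
    using E(1) by (simp_all add: is_trivialization_def)
  have "partial1 E = (\<lambda>p. E p ** A p)" "partial2 E = (\<lambda>p. E p ** B p)"
    using partial1_eqI[OF d(1)] partial2_eqI[OF d(2)] by (simp_all add: fun_eq_iff)
  moreover have "partial2 (\<lambda>p. E p ** A p) (x, y)
      = E (x, y) ** partial2 A (x, y) + E (x, y) ** B (x, y) ** A (x, y)"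
    by (intro partial2_eqI matrix_mult.has_vector_derivative d smooth_has_partial2 A)
  moreover have "partial1 (\<lambda>p. E p ** B p) (x, y)
      = E (x, y) ** partial1 B (x, y) + E (x, y) ** A (x, y) ** B (x, y)"
    by (intro partial1_eqI matrix_mult.has_vector_derivative d smooth_has_partial1 B)
  ultimately have "E p ** partial2 A p + E p ** B p ** A p = E p ** partial1 B p + E p ** A p ** B p"
    using smooth_mixed_partials[OF E(2)] by (simp add: p)
  then have "E p ** (partial2 A p - partial1 B p - commutator (A p) (B p)) = 0"
    by (simp add: commutator_def matrix_mult_linear matrix_mul_assoc algebra_simps)
  then have "conj_transpose (E p) ** E p ** (partial2 A p - partial1 B p - commutator (A p) (B p)) = 0"
    by (simp flip: matrix_mul_assoc)
  then show ?thesis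
    by (simp add: SU_cancel[OF E(3)])
qed

section \<open>Wave maps and the flow\<close>

lemma cscale_1 [simp]: "cscale 1 A = A"
  by (simp add: cscale_def vec_eq_iff)

lemma cscale_minus_1 [simp]: "cscale (- 1) A = - A"
  by (simp add: cscale_def vec_eq_iff)

lemma matrix_inv_right: "invertible A \<Longrightarrow> A ** matrix_inv A = mat 1" for A :: "complex^'n^'n"
  using matrix_inv_eqI invertible_right_inverse by metis

section \<open>Light cone coordinates\<close>

lemma light_cone_eq:
  "light_cone p = (1 / 2 * fst p + 1 / 2 * snd p, 1 / 2 * fst p + (- 1 / 2) * snd p)"
  by (cases p) (simp add: light_cone_def field_simps)

lemma smooth_light_cone_iff: "smooth (f \<circ> light_cone) \<longleftrightarrow> smooth f"
proof
  assume "smooth (f \<circ> light_cone)"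
  \<comment> \<open>The inverse substitution is x = \<xi> + \<eta>, t = \<xi> - \<eta>.\<close>
  from smooth_linear_substitution[OF this, of 1 1 1 "- 1"] show "smooth f"
    by (simp add: light_cone_def field_simps)
next
  assume "smooth f"
  from smooth_linear_substitution[OF this, of "1 / 2" "1 / 2" "1 / 2" "- 1 / 2"]
  show "smooth (f \<circ> light_cone)"
    by (simp add: o_def light_cone_eq)
qed

lemma partial1_light_cone:
  assumes "smooth f"
  shows "partial1 (f \<circ> light_cone) p
    = (1 / 2) *\<^sub>R (partial1 f (light_cone p) + partial2 f (light_cone p))"
proof (cases p)
  case (Pair x t)
  have lc: "light_cone (r, t) = (t / 2 + 1 / 2 * r, - t / 2 + 1 / 2 * r)" for r
    by (simp add: light_cone_def field_simps)
  have "((\<lambda>r. (f \<circ> light_cone) (r, t)) has_vector_derivative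
      (1 / 2) *\<^sub>R partial1 f (light_cone (x, t)) + (1 / 2) *\<^sub>R partial2 f (light_cone (x, t))) (at x)"
    unfolding o_def lc by (rule has_vector_derivative_along_line[OF smooth_C_order[OF assms]])
  from partial1_eqI[OF this] show ?thesis
    by (simp add: Pair o_def scaleR_add_right)
qed

lemma partial2_light_cone:
  assumes "smooth f"
  shows "partial2 (f \<circ> light_cone) p
    = (1 / 2) *\<^sub>R (partial1 f (light_cone p) - partial2 f (light_cone p))"
proof (cases p)
  case (Pair x t)
  have lc: "light_cone (x, r) = (x / 2 + 1 / 2 * r, x / 2 + (- 1 / 2) * r)" for r
    by (simp add: light_cone_def field_simps)
  have "((\<lambda>r. (f \<circ> light_cone) (x, r)) has_vector_derivative
      (1 / 2) *\<^sub>R partial1 f (light_cone (x, t)) + (- 1 / 2) *\<^sub>R partial2 f (light_cone (x, t))) (at t)"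
    unfolding o_def lc by (rule has_vector_derivative_along_line[OF smooth_C_order[OF assms]])
  from partial2_eqI[OF this] show ?thesis
    by (simp add: Pair o_def scaleR_diff_right)
qed

lemma partial1_smooth_rules:
  fixes f g :: "real \<times> real \<Rightarrow> 'b::real_normed_vector"
  assumes "smooth f" "smooth g"
  shows "partial1 (\<lambda>q. f q + g q) p = partial1 f p + partial1 g p"
    "partial1 (\<lambda>q. f q - g q) p = partial1 f p - partial1 g p"
    "partial1 (\<lambda>q. c *\<^sub>R f q) p = c *\<^sub>R partial1 f p"
  using smooth_has_partial1[OF assms(1)] smooth_has_partial1[OF assms(2)]
  by (cases p; auto intro!: partial1_eqI derivative_eq_intros)+

lemma partial2_smooth_rules:
  fixes f g :: "real \<times> real \<Rightarrow> 'b::real_normed_vector"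
  assumes "smooth f" "smooth g"
  shows "partial2 (\<lambda>q. f q + g q) p = partial2 f p + partial2 g p"
    "partial2 (\<lambda>q. f q - g q) p = partial2 f p - partial2 g p"
    "partial2 (\<lambda>q. c *\<^sub>R f q) p = c *\<^sub>R partial2 f p"
  using smooth_has_partial2[OF assms(1)] smooth_has_partial2[OF assms(2)]
  by (cases p; auto intro!: partial2_eqI derivative_eq_intros)+

text \<open>With \<alpha> and \<beta> the logarithmic derivatives in \<xi> and \<eta>, those in x
  and t are half the sum and half the difference. In the wave equation the \<xi>-derivative of
  \<alpha> and the \<eta>-derivative of \<beta> cancel, leaving the mixed terms.\<close>

lemma wave_map_light_cone_iff:
  fixes s :: "real \<times> real \<Rightarrow> complex^'n^'n"
  shows "wave_map (s \<circ> light_cone) \<longleftrightarrow> smooth s \<and> (\<forall>p. s p \<in> SU) \<and>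
    (\<forall>p. partial2 (\<lambda>q. conj_transpose (s q) ** partial1 s q) p
       + partial1 (\<lambda>q. conj_transpose (s q) ** partial2 s q) p = 0)"
proof -
  have inverse: "light_cone (fst p + snd p, fst p - snd p) = p" for p
    by (cases p) (simp add: light_cone_def)
  \<comment> \<open>\<open>light_cone\<close> is onto, so conditions at all (x, t) and at all
    (\<xi>, \<eta>) agree.\<close>
  have all: "(\<forall>p. P (light_cone p)) \<longleftrightarrow> (\<forall>p. P p)" for P
    using inverse by metis
  show ?thesis
  proof (cases "smooth s \<and> (\<forall>p. s p \<in> SU)")
    case True
    then have s: "smooth s" and SU: "\<And>p. s p \<in> SU"
      by auto
    define \<alpha> where "\<alpha> = (\<lambda>q. conj_transpose (s q) ** partial1 s q)"
    define \<beta> where "\<beta> = (\<lambda>q. conj_transpose (s q) ** partial2 s q)"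
    have \<alpha>: "smooth \<alpha>" and \<beta>: "smooth \<beta>"
      unfolding \<alpha>_def \<beta>_def
      by (intro smooth_mult smooth_conj_transpose s smooth_partial1 smooth_partial2)+
    have "(\<lambda>q. matrix_inv ((s \<circ> light_cone) q) ** partial1 (s \<circ> light_cone) q)
        = (\<lambda>q. (1 / 2) *\<^sub>R (\<alpha> q + \<beta> q)) \<circ> light_cone"
      by (simp add: fun_eq_iff partial1_light_cone[OF s] SU_matrix_inv[OF SU] \<alpha>_def \<beta>_def
        matrix_mult_linear)
    moreover have "(\<lambda>q. matrix_inv ((s \<circ> light_cone) q) ** partial2 (s \<circ> light_cone) q)
        = (\<lambda>q. (1 / 2) *\<^sub>R (\<alpha> q - \<beta> q)) \<circ> light_cone"
      by (simp add: fun_eq_iff partial2_light_cone[OF s] SU_matrix_inv[OF SU] \<alpha>_def \<beta>_def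
        matrix_mult_linear)
    ultimately have "wave_map (s \<circ> light_cone) \<longleftrightarrow> (\<forall>p.
        partial2 ((\<lambda>q. (1 / 2) *\<^sub>R (\<alpha> q - \<beta> q)) \<circ> light_cone) p
        = partial1 ((\<lambda>q. (1 / 2) *\<^sub>R (\<alpha> q + \<beta> q)) \<circ> light_cone) p)"
      unfolding wave_map_def using s SU by (simp add: smooth_light_cone_iff)
    also have "\<dots> \<longleftrightarrow> (\<forall>p. (\<lambda>q. (partial1 \<alpha> q - partial1 \<beta> q) - (partial2 \<alpha> q - partial2 \<beta> q)
        = (partial1 \<alpha> q + partial1 \<beta> q) + (partial2 \<alpha> q + partial2 \<beta> q)) (light_cone p))"
      using \<alpha> \<beta>
      by (simp add: partial1_light_cone partial2_light_cone partial1_smooth_rules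
        partial2_smooth_rules smooth_scaleR smooth_add smooth_diff
        flip: scaleR_add_right scaleR_diff_right)
    also have "\<dots> \<longleftrightarrow> (\<forall>p. partial2 \<alpha> p + partial1 \<beta> p = 0)"
    proof -
      have swap: "(a - b) - (c - d) = (a + b) + (c + d) \<longleftrightarrow> c + b = 0" for a b c d :: "complex^'n^'n"
      proof -
        have "(a - b) - (c - d) = (a + b) + (c + d) \<longleftrightarrow> 2 *\<^sub>R (c + b) = 0"
          by (auto simp: algebra_simps scaleR_2)
        then show ?thesis by simp
      qed
      show ?thesis
        by (simp only: swap all[of "\<lambda>q. partial2 \<alpha> q + partial1 \<beta> q = 0"])
    qed
    finally show ?thesis
      using True by (simp add: \<alpha>_def \<beta>_def)
  next
    case False
    then show ?thesis
      using all[of "\<lambda>p. s p \<in> SU"] by (auto simp: wave_map_def smooth_light_cone_iff)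
  qed
qed

section \<open>From the flow to wave maps\<close>

lemma flow_trivialization_plus_minus_1:
  "flow_trivialization a u v 1 = trivialization (\<lambda>p. a p + u p) v"
  "flow_trivialization a u v (- 1) = trivialization (\<lambda>p. - a p + u p) (\<lambda>p. - v p)"
  by (simp_all add: flow_trivialization_def)

text \<open>In the derivatives of \<open>s\<close> the terms in \<open>u\<close> cancel and those in
  \<open>a\<close> or \<open>v\<close> double. The wave equation then says that E[v, a] and E[a, v],
  each times the adjoint of \<open>E\<close>, add up to zero.\<close>

lemma flow_imp_wave_map:
  fixes a u v :: "real \<times> real \<Rightarrow> complex^'n^'n"
  assumes flow: "minus_one_flow_solution a u v"
  defines "\<Phi> \<equiv> flow_trivialization a u v" and "s \<equiv> corresponding_wave_map a u v"
  shows "wave_map (s \<circ> light_cone)"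
    and "matrix_inv (s p) ** partial1 s p = (- 2) *\<^sub>R (\<Phi> 1 p ** a p ** matrix_inv (\<Phi> 1 p))"
    and "matrix_inv (s p) ** partial2 s p = (- 2) *\<^sub>R (\<Phi> 1 p ** v p ** matrix_inv (\<Phi> 1 p))"
proof -
  have smooth: "smooth a" "smooth u" "smooth v"
    and su: "\<And>p. a p \<in> su" "\<And>p. u p \<in> su" "\<And>p. v p \<in> su"
    and eqs: "\<And>p. partial2 a p = 0" "\<And>p. partial2 u p = commutator (a p) (v p)"
      "\<And>p. partial1 v p = - commutator (u p) (v p)"
    using flow unfolding minus_one_flow_solution_def by blast+
  have uminus_rule: "partial2 (\<lambda>q. - a q) p = - partial2 a p" "partial1 (\<lambda>q. - v q) p = - partial1 v p" for p
    using partial2_smooth_rules(3)[OF smooth(1,1), of "- 1"]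
      partial1_smooth_rules(3)[OF smooth(3,3), of "- 1"] by simp_all
  have skew: "conj_transpose (X p) = - X p" if "\<And>p. X p \<in> su" for X :: "real \<times> real \<Rightarrow> complex^'n^'n" and p
    using that by (simp add: su_def)
  have sm: "smooth (\<lambda>p. a p + u p)" "smooth (\<lambda>p. - a p + u p)" "smooth (\<lambda>p. - v p)"
    by (intro smooth_add smooth_uminus smooth)+
  have sums: "a p + u p \<in> su" "- a p + u p \<in> su" "- v p \<in> su" for p
    by (intro su_add su_uminus su)+
  have "partial2 (\<lambda>p. a p + u p) p - partial1 v p = commutator (a p + u p) (v p)" for p
    using smooth by (simp add: partial2_smooth_rules eqs commutator_def matrix_mult_linear)
  then obtain E where E: "smooth E" "\<And>p. E p \<in> SU" "is_trivialization (\<lambda>p. a p + u p) v E"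
    using flat_trivialization_exists[OF sm(1) sums(1) smooth(3) su(3)] by blast
  have "partial2 (\<lambda>p. - a p + u p) p - partial1 (\<lambda>p. - v p) p
      = commutator (- a p + u p) (- v p)" for p
    using partial2_smooth_rules(1)[OF smooth_uminus[OF smooth(1)] smooth(2), of p]
    by (simp only: uminus_rule eqs commutator_def matrix_mult_linear) simp
  then obtain F where F: "smooth F" "\<And>p. F p \<in> SU"
    "is_trivialization (\<lambda>p. - a p + u p) (\<lambda>p. - v p) F"
    using flat_trivialization_exists[OF sm(2) sums(2) sm(3) sums(3)] by blast
  have \<Phi>E: "\<Phi> 1 = E" and \<Phi>F: "\<Phi> (- 1) = F"
    unfolding \<Phi>_def flow_trivialization_plus_minus_1
    using trivialization_eqI[OF E(3,2) sums(1) su(3)] trivialization_eqI[OF F(3,2) sums(2,3)]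
    by blast+
  have s: "s = (\<lambda>p. F p ** conj_transpose (E p))"
    using \<Phi>E \<Phi>F by (simp add: fun_eq_iff s_def \<Phi>_def corresponding_wave_map_def SU_matrix_inv[OF E(2)])
  have dE: "((\<lambda>t. E (t, y)) has_vector_derivative E (x, y) ** (a (x, y) + u (x, y))) (at x)"
    "((\<lambda>t. E (x, t)) has_vector_derivative E (x, y) ** v (x, y)) (at y)" for x y
    using E(3) by (simp_all add: is_trivialization_def)
  have dF: "((\<lambda>t. F (t, y)) has_vector_derivative F (x, y) ** (- a (x, y) + u (x, y))) (at x)"
    "((\<lambda>t. F (x, t)) has_vector_derivative F (x, y) ** - v (x, y)) (at y)" for x y
    using F(3) by (simp_all add: is_trivialization_def)
  have s1: "partial1 s (x, y) = (- 2) *\<^sub>R (F (x, y) ** a (x, y) ** conj_transpose (E (x, y)))" for x y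
  proof -
    \<comment> \<open>Writes the coefficient in the shape of
      \<open>has_vector_derivative_mult_conj_transpose\<close> with \<open>X\<close> the constant
      identity.\<close>
    have eq: "(- 2) *\<^sub>R a (x, y) = (- a (x, y) + u (x, y)) ** mat 1 - mat 1 ** (a (x, y) + u (x, y)) + 0"
      by (simp add: scaleR_2)
    have "((\<lambda>t. F (t, y) ** mat 1 ** conj_transpose (E (t, y))) has_vector_derivative
        F (x, y) ** ((- 2) *\<^sub>R a (x, y)) ** conj_transpose (E (x, y))) (at x)"
      unfolding eq
      by (intro has_vector_derivative_mult_conj_transpose has_vector_derivative_const dF dE skew sums(1))
    then show ?thesis
      by (intro partial1_eqI)
        (simp only: s matrix_mult.scaleR_left matrix_mult.scaleR_right matrix_mul_rid)
  qed
  have s2: "partial2 s (x, y) = (- 2) *\<^sub>R (F (x, y) ** v (x, y) ** conj_transpose (E (x, y)))" for x y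
  proof -
    have eq: "(- 2) *\<^sub>R v (x, y) = (- v (x, y)) ** mat 1 - mat 1 ** (v (x, y)) + 0"
      by (simp add: scaleR_2)
    have "((\<lambda>t. F (x, t) ** mat 1 ** conj_transpose (E (x, t))) has_vector_derivative
        F (x, y) ** ((- 2) *\<^sub>R v (x, y)) ** conj_transpose (E (x, y))) (at y)"
      unfolding eq
      by (intro has_vector_derivative_mult_conj_transpose has_vector_derivative_const dF dE skew su(3))
    then show ?thesis
      by (intro partial2_eqI)
        (simp only: s matrix_mult.scaleR_left matrix_mult.scaleR_right matrix_mul_rid)
  qed
  have sSU: "s p \<in> SU" for p
    unfolding s by (intro SU_mult SU_conj_transpose E F)
  have \<alpha>: "conj_transpose (s p) ** partial1 s p = (- 2) *\<^sub>R (E p ** a p ** conj_transpose (E p))" for p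
    using s1[of "fst p" "snd p"]
    by (simp add: s conj_transpose_mult matrix_mult_linear matrix_mul_assoc SU_cancel[OF F(2)])
  have \<beta>: "conj_transpose (s p) ** partial2 s p = (- 2) *\<^sub>R (E p ** v p ** conj_transpose (E p))" for p
    using s2[of "fst p" "snd p"]
    by (simp add: s conj_transpose_mult matrix_mult_linear matrix_mul_assoc SU_cancel[OF F(2)])
  show "matrix_inv (s p) ** partial1 s p = (- 2) *\<^sub>R (\<Phi> 1 p ** a p ** matrix_inv (\<Phi> 1 p))"
    "matrix_inv (s p) ** partial2 s p = (- 2) *\<^sub>R (\<Phi> 1 p ** v p ** matrix_inv (\<Phi> 1 p))"
    using \<alpha> \<beta> by (simp_all add: SU_matrix_inv[OF sSU] SU_matrix_inv[OF E(2)] \<Phi>E)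
  have smE: "smooth (\<lambda>p. E p ** X p ** conj_transpose (E p))" if "smooth X" for X
    by (intro smooth_mult smooth_conj_transpose E that)
  have "partial2 (\<lambda>p. conj_transpose (s p) ** partial1 s p) (x, y)
      + partial1 (\<lambda>p. conj_transpose (s p) ** partial2 s p) (x, y) = 0" for x y
  proof -
    have "((\<lambda>t. E (x, t) ** a (x, t) ** conj_transpose (E (x, t))) has_vector_derivative
        E (x, y) ** (v (x, y) ** a (x, y) - a (x, y) ** v (x, y) + partial2 a (x, y))
          ** conj_transpose (E (x, y))) (at y)"
      by (intro has_vector_derivative_mult_conj_transpose dE smooth_has_partial2 smooth skew su)
    then have "partial2 (\<lambda>p. E p ** a p ** conj_transpose (E p)) (x, y)
        = E (x, y) ** commutator (v (x, y)) (a (x, y)) ** conj_transpose (E (x, y))"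
      by (intro partial2_eqI) (simp add: eqs commutator_def)
    \<comment> \<open>Differentiation produces [a + u, v]; the flow equation for the
      \<xi>-derivative of \<open>v\<close> removes [u, v].\<close>
    moreover have "((\<lambda>t. E (t, y) ** v (t, y) ** conj_transpose (E (t, y))) has_vector_derivative
        E (x, y) ** ((a (x, y) + u (x, y)) ** v (x, y) - v (x, y) ** (a (x, y) + u (x, y))
          + partial1 v (x, y)) ** conj_transpose (E (x, y))) (at x)"
      by (intro has_vector_derivative_mult_conj_transpose dE smooth_has_partial1 smooth skew sums)
    then have "partial1 (\<lambda>p. E p ** v p ** conj_transpose (E p)) (x, y)
        = E (x, y) ** commutator (a (x, y)) (v (x, y)) ** conj_transpose (E (x, y))"
      by (intro partial1_eqI) (simp add: eqs commutator_def matrix_mult_linear)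
    ultimately show ?thesis
      unfolding \<alpha> \<beta> partial1_smooth_rules(3)[OF smE smE, OF smooth(3,3)]
        partial2_smooth_rules(3)[OF smE smE, OF smooth(1,1)]
      by (simp add: commutator_def matrix_mult_linear scaleR_diff_right)
  qed
  then show "wave_map (s \<circ> light_cone)"
    unfolding wave_map_light_cone_iff using sSU E(1) F(1)
    by (auto simp: s intro!: smooth_mult smooth_conj_transpose)
qed

section \<open>From wave maps to the flow\<close>

text \<open>The coefficient lies in su(n), so any half solution is forced to equal \<open>Y\<close>.
  A function assumed differentiable in \<eta> only thereby acquires the smoothness of the
  constructed solution.\<close>

lemma is_half_solution_iff:
  fixes s Y :: "real \<times> real \<Rightarrow> complex^'n^'n"
  assumes s: "smooth s" "\<And>p. s p \<in> SU"
    and Y: "\<And>p. Y p \<in> SU" "\<And>x. Y (x, 0) = mat 1"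
      "\<And>x y. ((\<lambda>t. Y (x, t)) has_vector_derivative
        Y (x, y) ** ((1 / 2) *\<^sub>R (conj_transpose (s (x, y)) ** partial2 s (x, y)))) (at y)"
  shows "is_half_solution s \<psi> \<longleftrightarrow> \<psi> = Y"
proof
  have su: "(1 / 2) *\<^sub>R (conj_transpose (s (x, y)) ** partial2 s (x, y)) \<in> su" for x y
    by (rule su_scaleR, rule SU_logarithmic_derivative[OF smooth_has_partial2[OF s(1)] s(2)])
  assume \<psi>: "is_half_solution s \<psi>"
  have "((\<lambda>t. \<psi> (x, t)) has_vector_derivative
      \<psi> (x, y) ** ((1 / 2) *\<^sub>R (conj_transpose (s (x, y)) ** partial2 s (x, y)))) (at y)" for x y
  proof -
    have inv: "invertible (\<psi> (x, y))" and diff: "(\<lambda>t. \<psi> (x, t)) differentiable at y"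
      and eq: "matrix_inv (\<psi> (x, y)) ** partial2 \<psi> (x, y)
        = (1 / 2) *\<^sub>R (matrix_inv (s (x, y)) ** partial2 s (x, y))"
      using \<psi> unfolding is_half_solution_def by blast+
    have "partial2 \<psi> (x, y) = \<psi> (x, y) ** (matrix_inv (\<psi> (x, y)) ** partial2 \<psi> (x, y))"
      using inv by (simp add: matrix_mul_assoc matrix_inv_right)
    also have "\<dots> = \<psi> (x, y) ** ((1 / 2) *\<^sub>R (conj_transpose (s (x, y)) ** partial2 s (x, y)))"
      unfolding eq by (simp add: SU_matrix_inv[OF s(2)])
    finally show ?thesis
      using diff unfolding vector_derivative_works by (simp add: partial2_def)
  qed
  note d = this
  show "\<psi> = Y"
  proof
    fix p :: "real \<times> real"
    obtain x y where p: "p = (x, y)"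
      by (cases p)
    have "\<psi> (x, y) ** conj_transpose (Y (x, y)) = \<psi> (x, 0) ** conj_transpose (Y (x, 0))"
      by (rule skew_ode_constant[where U = "\<lambda>t. \<psi> (x, t)", OF d Y(3)])
        (use su in \<open>simp add: su_def\<close>)
    also have "\<dots> = mat 1"
      using \<psi> by (simp add: is_half_solution_def Y(2))
    finally show "\<psi> p = Y p"
      using SU_cancel(3)[OF Y(1), of "\<psi> p" p] by (simp add: p)
  qed
next
  assume "\<psi> = Y"
  moreover have "partial2 Y (x, y)
      = Y (x, y) ** ((1 / 2) *\<^sub>R (conj_transpose (s (x, y)) ** partial2 s (x, y)))" for x y
    by (rule partial2_eqI[OF Y(3)])
  moreover have "(\<lambda>t. Y (x, t)) differentiable at y" for x y
    using Y(3) differentiableI_vector by blast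
  ultimately show "is_half_solution s \<psi>"
    unfolding is_half_solution_def
    using SU_invertible[OF Y(1)]
    by (simp add: Y(2) SU_matrix_inv[OF Y(1)] SU_matrix_inv[OF s(2)] matrix_mul_assoc
      matrix_mult_linear SU_cancel[OF Y(1)])
qed

text \<open>Flatness at \<open>1\<close> and at \<open>-1\<close> gives two linear equations for the
  unknown derivatives of \<open>u\<close> and \<open>v\<close>; since \<open>a\<close> does not
  depend on \<eta>, their sum isolates one and their difference the other.\<close>

lemma flow_equations_if_trivializations:
  fixes a u v :: "real \<times> real \<Rightarrow> complex^'n^'n"
  assumes E: "is_trivialization (\<lambda>p. a p + u p) v E" "smooth E" "\<And>p. E p \<in> SU"
    and F: "is_trivialization (\<lambda>p. - a p + u p) (\<lambda>p. - v p) F" "smooth F" "\<And>p. F p \<in> SU"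
    and smooth: "smooth a" "smooth u" "smooth v"
    and su: "\<And>p. a p \<in> su" "\<And>p. u p \<in> su" "\<And>p. v p \<in> su"
    and a: "\<And>p. partial2 a p = 0"
  shows "minus_one_flow_solution a u v"
proof -
  have "partial2 u p = commutator (a p) (v p) \<and> partial1 v p = - commutator (u p) (v p)" for p
  proof -
    have 1: "partial2 u p - partial1 v p = commutator (a p + u p) (v p)"
      using flat_if_trivialization[OF E smooth_add[OF smooth(1,2)] smooth(3), of p]
      by (simp add: partial2_smooth_rules(1)[OF smooth(1,2)] a)
    have "partial2 (\<lambda>q. - a q) p = 0" "partial1 (\<lambda>q. - v q) p = - partial1 v p"
      using partial2_smooth_rules(3)[OF smooth(1,1), of "- 1"]
        partial1_smooth_rules(3)[OF smooth(3,3), of "- 1"] by (simp_all add: a)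
    then have 2: "partial2 u p + partial1 v p = commutator (- a p + u p) (- v p)"
      using flat_if_trivialization[OF F smooth_add[OF smooth_uminus[OF smooth(1)] smooth(2)]
          smooth_uminus[OF smooth(3)], of p]
        partial2_smooth_rules(1)[OF smooth_uminus[OF smooth(1)] smooth(2), of p] by simp
    have "2 *\<^sub>R partial2 u p = 2 *\<^sub>R commutator (a p) (v p)"
      using arg_cong2[OF 1 2, of "(+)"]
      by (simp add: commutator_def matrix_mult_linear scaleR_2 algebra_simps)
    moreover have "2 *\<^sub>R partial1 v p = 2 *\<^sub>R (- commutator (u p) (v p))"
      using arg_cong2[OF 2 1, of "(-)"]
      by (simp add: commutator_def matrix_mult_linear scaleR_2 algebra_simps)
    ultimately show ?thesis
      unfolding scaleR_cancel_left by simp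
  qed
  then show ?thesis
    unfolding minus_one_flow_solution_def using smooth su a by blast
qed

text \<open>Here \<open>Y\<close> is \<psi>. The definition of \<open>u\<close> is exactly what
  makes the adjoint of \<open>Y\<close> trivialize the form at \<open>1\<close> for the first
  component \<open>- a\<close>; multiplying by \<open>s\<close> on the left reverses the signs of
  \<open>a\<close> and \<open>v\<close>, which gives the form at \<open>-1\<close>.\<close>

lemma wave_map_imp_flow:
  fixes s Y :: "real \<times> real \<Rightarrow> complex^'n^'n"
  assumes wave: "wave_map (s \<circ> light_cone)" and s0: "s (0, 0) = mat 1"
    and Y: "smooth Y" "\<And>p. Y p \<in> SU" "\<And>x. Y (x, 0) = mat 1"
      "\<And>x y. ((\<lambda>t. Y (x, t)) has_vector_derivative
        Y (x, y) ** ((1 / 2) *\<^sub>R (conj_transpose (s (x, y)) ** partial2 s (x, y)))) (at y)"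
  defines "a \<equiv> \<lambda>p. (1 / 2) *\<^sub>R (conj_transpose (s (fst p, 0)) ** partial1 s (fst p, 0))"
  defines "u \<equiv> \<lambda>p. a p - partial1 Y p ** conj_transpose (Y p)"
  defines "v \<equiv> \<lambda>p. - (1 / 2) *\<^sub>R (Y p ** (conj_transpose (s p) ** partial2 s p) ** conj_transpose (Y p))"
  shows "minus_one_flow_solution (\<lambda>p. - a p) u v \<and> s = corresponding_wave_map (\<lambda>p. - a p) u v"
proof -
  have s: "smooth s" and SU: "\<And>p. s p \<in> SU"
    and eq: "\<And>p. partial2 (\<lambda>q. conj_transpose (s q) ** partial1 s q) p
       + partial1 (\<lambda>q. conj_transpose (s q) ** partial2 s q) p = 0"
    using wave unfolding wave_map_light_cone_iff by blast+
  define \<alpha> where "\<alpha> = (\<lambda>q. conj_transpose (s q) ** partial1 s q)"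
  define \<beta> where "\<beta> = (\<lambda>q. conj_transpose (s q) ** partial2 s q)"
  have \<alpha>: "smooth \<alpha>" "\<And>p. \<alpha> p \<in> su" and \<beta>: "smooth \<beta>" "\<And>p. \<beta> p \<in> su"
  proof -
    show "smooth \<alpha>" "smooth \<beta>"
      unfolding \<alpha>_def \<beta>_def
      by (intro smooth_mult smooth_conj_transpose s smooth_partial1 smooth_partial2)+
    show "\<alpha> p \<in> su" "\<beta> p \<in> su" for p
      using SU_logarithmic_derivative[OF smooth_has_partial1[OF s] SU, of "fst p" "snd p"]
        SU_logarithmic_derivative[OF smooth_has_partial2[OF s] SU, of "fst p" "snd p"]
      by (simp_all add: \<alpha>_def \<beta>_def)
  qed
  have s1: "partial1 s p = s p ** \<alpha> p" and s2: "partial2 s p = s p ** \<beta> p" for p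
    by (simp_all add: \<alpha>_def \<beta>_def matrix_mul_assoc SU_cancel[OF SU])
  have ds: "((\<lambda>t. s (t, y)) has_vector_derivative s (x, y) ** \<alpha> (x, y)) (at x)"
    "((\<lambda>t. s (x, t)) has_vector_derivative s (x, y) ** \<beta> (x, y)) (at y)" for x y
    using smooth_has_partial1[OF s] smooth_has_partial2[OF s] by (simp_all flip: s1 s2)
  \<comment> \<open>Since \<open>s (0, 0)\<close> is the identity, \<open>s\<close> trivializes its
    own Maurer-Cartan form, which is therefore flat.\<close>
  have "is_trivialization \<alpha> \<beta> s"
    unfolding is_trivialization_def using s0 ds SU_invertible[OF SU] by blast
  from flat_if_trivialization[OF this s SU \<alpha>(1) \<beta>(1)]
  have flat: "partial2 \<alpha> p - partial1 \<beta> p = commutator (\<alpha> p) (\<beta> p)" for p .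
  have \<alpha>2: "partial2 \<alpha> p = (1 / 2) *\<^sub>R commutator (\<alpha> p) (\<beta> p)" for p
  proof -
    have "partial1 \<beta> p = - partial2 \<alpha> p"
      using eq[of p] unfolding \<alpha>_def \<beta>_def by (simp add: eq_neg_iff_add_eq_0 add.commute)
    \<comment> \<open>The wave equation merges the two derivatives in the flatness condition into
      one.\<close>
    then have "2 *\<^sub>R partial2 \<alpha> p = commutator (\<alpha> p) (\<beta> p)"
      using flat[of p] by (simp add: scaleR_2)
    then show ?thesis
      by (simp flip: \<open>2 *\<^sub>R partial2 \<alpha> p = _\<close>)
  qed
  have dY: "((\<lambda>t. Y (x, t)) has_vector_derivative Y (x, y) ** ((1 / 2) *\<^sub>R \<beta> (x, y))) (at y)" for x y
    using Y(4) by (simp add: \<beta>_def)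
  have skew\<beta>: "conj_transpose ((1 / 2) *\<^sub>R \<beta> p) = - ((1 / 2) *\<^sub>R \<beta> p)" for p
    using su_scaleR[OF \<beta>(2)] by (simp add: su_def)
  \<comment> \<open>Conjugation by \<open>Y\<close> contributes half of [\<beta>, \<alpha>], which
    cancels the \<eta>-derivative of \<alpha>. The conjugate thus keeps its value at \<eta> = 0,
    where \<open>Y\<close> is the identity.\<close>
  have conj\<alpha>: "Y p ** \<alpha> p ** conj_transpose (Y p) = 2 *\<^sub>R a p" for p
  proof -
    have "((\<lambda>t. Y (x, t) ** \<alpha> (x, t) ** conj_transpose (Y (x, t))) has_vector_derivative 0) (at y)" for x y
    proof -
      have "((\<lambda>t. Y (x, t) ** \<alpha> (x, t) ** conj_transpose (Y (x, t))) has_vector_derivative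
          Y (x, y) ** ((1 / 2) *\<^sub>R \<beta> (x, y) ** \<alpha> (x, y) - \<alpha> (x, y) ** ((1 / 2) *\<^sub>R \<beta> (x, y))
            + partial2 \<alpha> (x, y)) ** conj_transpose (Y (x, y))) (at y)"
        by (intro has_vector_derivative_mult_conj_transpose dY smooth_has_partial2 \<alpha> skew\<beta>)
      moreover have "(1 / 2) *\<^sub>R \<beta> (x, y) ** \<alpha> (x, y) - \<alpha> (x, y) ** ((1 / 2) *\<^sub>R \<beta> (x, y))
          + partial2 \<alpha> (x, y) = 0"
        by (simp add: \<alpha>2 commutator_def matrix_mult_linear scaleR_diff_right)
      ultimately show ?thesis
        by simp
    qed
    from constant_if_zero_vector_derivative[OF this, of "fst p" "snd p" 0] show ?thesis
      by (simp add: Y(3) a_def \<alpha>_def)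
  qed
  have a: "smooth a" "\<And>p. a p \<in> su" "\<And>p. partial2 a p = 0"
  proof -
    have a_eq: "a = (\<lambda>p. (1 / 2) *\<^sub>R \<alpha> (1 * fst p + 0 * snd p, 0 * fst p + 0 * snd p))"
      by (simp add: a_def \<alpha>_def)
    show "smooth a"
      unfolding a_eq by (intro smooth_scaleR smooth_linear_substitution \<alpha>)
    show "a p \<in> su" for p
      unfolding a_eq by (intro su_scaleR \<alpha>)
    show "partial2 a p = 0" for p
      by (cases p) (auto intro!: partial2_eqI simp: a_def)
  qed
  have v_eq: "v p = - (Y p ** ((1 / 2) *\<^sub>R \<beta> p) ** conj_transpose (Y p))" for p
    by (simp add: v_def \<beta>_def matrix_mult_linear)
  have v: "smooth v" "\<And>p. v p \<in> su"
    unfolding v_eq[abs_def]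
    by (intro smooth_uminus smooth_mult smooth_conj_transpose smooth_scaleR Y \<beta>
      su_uminus su_conjugate su_scaleR)+
  have Y1su: "conj_transpose (Y p) ** partial1 Y p \<in> su" for p
    using SU_logarithmic_derivative[OF smooth_has_partial1[OF Y(1)] Y(2), of "fst p" "snd p"] by simp
  have u: "smooth u" "\<And>p. u p \<in> su"
  proof -
    show "smooth u"
      unfolding u_def by (intro smooth_diff smooth_mult smooth_conj_transpose a Y smooth_partial1)
    have "u p = a p + - (Y p ** (conj_transpose (Y p) ** partial1 Y p) ** conj_transpose (Y p))" for p
      by (simp add: u_def matrix_mul_assoc SU_cancel[OF Y(2)])
    then show "u p \<in> su" for p
      by (simp only:) (intro su_add su_uminus su_conjugate a Y Y1su)
  qed
  define E where "E = (\<lambda>p. conj_transpose (Y p))"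
  define F where "F = (\<lambda>p. s p ** conj_transpose (Y p))"
  have E: "smooth E" "\<And>p. E p \<in> SU" and F: "smooth F" "\<And>p. F p \<in> SU"
    unfolding E_def F_def by (intro smooth_mult smooth_conj_transpose SU_mult SU_conj_transpose s SU Y)+
  have E1: "((\<lambda>t. E (t, y)) has_vector_derivative E (x, y) ** (- a (x, y) + u (x, y))) (at x)" for x y
  proof -
    let ?Y = "Y (x, y)" and ?Y1 = "partial1 Y (x, y)"
    \<comment> \<open>Skewness of the logarithmic derivative of \<open>Y\<close> expresses the
      derivative of the adjoint with that adjoint as left factor, as a trivialization
      requires.\<close>
    have "conj_transpose ?Y1 ** ?Y = - (conj_transpose ?Y ** ?Y1)"
      using Y1su[of "(x, y)"] by (simp add: su_def conj_transpose_mult)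
    then have "conj_transpose ?Y1 ** ?Y ** conj_transpose ?Y
        = - (conj_transpose ?Y ** ?Y1) ** conj_transpose ?Y"
      by simp
    then have "conj_transpose ?Y1 = conj_transpose ?Y ** (- a (x, y) + u (x, y))"
      by (simp add: SU_cancel[OF Y(2)] u_def matrix_mult_linear matrix_mul_assoc)
    then show ?thesis
      unfolding E_def
      using bounded_linear.has_vector_derivative[OF bounded_linear_conj_transpose
          smooth_has_partial1[OF Y(1)], of y x] by simp
  qed
  have E2: "((\<lambda>t. E (x, t)) has_vector_derivative E (x, y) ** v (x, y)) (at y)" for x y
  proof -
    have "conj_transpose (Y (x, y) ** ((1 / 2) *\<^sub>R \<beta> (x, y))) = E (x, y) ** v (x, y)"
      unfolding conj_transpose_mult skew\<beta> v_eq E_def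
      by (simp add: matrix_mult.minus_right matrix_mult.minus_left matrix_mul_assoc SU_cancel[OF Y(2)])
    then show ?thesis
      using bounded_linear.has_vector_derivative[OF bounded_linear_conj_transpose dY, of x y]
      by (simp add: E_def)
  qed
  have F1: "((\<lambda>t. F (t, y)) has_vector_derivative F (x, y) ** (a (x, y) + u (x, y))) (at x)" for x y
  proof -
    let ?Y = "Y (x, y)"
    have "((\<lambda>t. s (t, y) ** E (t, y)) has_vector_derivative
        s (x, y) ** (E (x, y) ** (- a (x, y) + u (x, y))) + s (x, y) ** \<alpha> (x, y) ** E (x, y)) (at x)"
      by (intro matrix_mult.has_vector_derivative ds E1)
    \<comment> \<open>Writing \<open>2 a\<close> as a sum lets one summand cancel the
      \<open>- a\<close> in the equation of \<open>E\<close> and the other reverse its sign.\<close>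
    moreover have \<alpha>E: "\<alpha> (x, y) ** E (x, y) = E (x, y) ** (a (x, y) + a (x, y))"
      unfolding E_def scaleR_2[symmetric] conj\<alpha>[symmetric]
      by (simp add: matrix_mul_assoc SU_cancel[OF Y(2)])
    have "s (x, y) ** (E (x, y) ** (- a (x, y) + u (x, y))) + s (x, y) ** \<alpha> (x, y) ** E (x, y)
        = F (x, y) ** (a (x, y) + u (x, y))"
      unfolding F_def E_def[symmetric] matrix_mul_assoc[symmetric] \<alpha>E
      unfolding matrix_mult.add_right[symmetric] by (simp add: E_def add.assoc)
    ultimately show ?thesis
      by (simp add: F_def E_def)
  qed
  have F2: "((\<lambda>t. F (x, t)) has_vector_derivative F (x, y) ** - v (x, y)) (at y)" for x y
  proof -
    have "((\<lambda>t. s (x, t) ** E (x, t)) has_vector_derivative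
        s (x, y) ** (E (x, y) ** v (x, y)) + s (x, y) ** \<beta> (x, y) ** E (x, y)) (at y)"
      by (intro matrix_mult.has_vector_derivative ds E2)
    moreover have "- v (x, y) - v (x, y) = Y (x, y) ** \<beta> (x, y) ** E (x, y)"
      by (simp add: v_eq E_def matrix_mult_linear flip: scaleR_left_distrib)
    then have \<beta>E: "\<beta> (x, y) ** E (x, y) = E (x, y) ** (- v (x, y) - v (x, y))"
      by (simp add: E_def matrix_mul_assoc SU_cancel[OF Y(2)])
    have "s (x, y) ** (E (x, y) ** v (x, y)) + s (x, y) ** \<beta> (x, y) ** E (x, y)
        = F (x, y) ** - v (x, y)"
      unfolding F_def E_def[symmetric] matrix_mul_assoc[symmetric] \<beta>E
      unfolding matrix_mult.add_right[symmetric] by (simp add: E_def)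
    ultimately show ?thesis
      by (simp add: F_def E_def)
  qed
  have E0: "E (0, 0) = mat 1" and F0: "F (0, 0) = mat 1"
    by (simp_all add: E_def F_def Y(3) s0)
  have trivE: "is_trivialization (\<lambda>p. - a p + u p) v E"
    unfolding is_trivialization_def using E0 E1 E2 SU_invertible[OF E(2)] by blast
  \<comment> \<open>The double minus is kept because the first component of the solution is
    \<open>- a\<close>, negated once more at \<open>-1\<close>.\<close>
  have trivF: "is_trivialization (\<lambda>p. - (- a p) + u p) (\<lambda>p. - v p) F"
    unfolding is_trivialization_def minus_minus using F0 F1 F2 SU_invertible[OF F(2)] by blast
  have a2: "partial2 (\<lambda>p. - a p) p = 0" for p
    by (cases p) (auto intro!: partial2_eqI simp: a_def)
  have "minus_one_flow_solution (\<lambda>p. - a p) u v"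
    by (rule flow_equations_if_trivializations[OF trivE E trivF F smooth_uminus[OF a(1)] u(1) v(1)
          su_uminus[OF a(2)] u(2) v(2) a2])
  moreover have "s = corresponding_wave_map (\<lambda>p. - a p) u v"
  proof
    fix p
    have "trivialization (\<lambda>p. - a p + u p) v = E"
      using trivE E(2) a u v by (intro trivialization_eqI su_add su_uminus) auto
    moreover have "trivialization (\<lambda>p. - (- a p) + u p) (\<lambda>p. - v p) = F"
      using trivF F(2) a u v by (intro trivialization_eqI su_add su_uminus) auto
    ultimately have "corresponding_wave_map (\<lambda>p. - a p) u v p = F p ** matrix_inv (E p)"
      unfolding corresponding_wave_map_def flow_trivialization_plus_minus_1 by simp
    then show "s p = corresponding_wave_map (\<lambda>p. - a p) u v p"
      by (simp add: SU_matrix_inv[OF E(2)]) (simp add: E_def F_def SU_cancel[OF Y(2)])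
  qed
  ultimately show ?thesis
    by blast
qed

theorem theorem4p2:
  shows
    "(\<forall>(a :: real \<times> real \<Rightarrow> complex^'n^'n) u v. minus_one_flow_solution a u v \<longrightarrow>
        (let \<Phi> = flow_trivialization a u v; s = corresponding_wave_map a u v in
           wave_map (s \<circ> light_cone) \<and>
           (\<forall>p. matrix_inv (s p) ** partial1 s p
                  = (- 2) *\<^sub>R (\<Phi> 1 p ** a p ** matrix_inv (\<Phi> 1 p))) \<and>
           (\<forall>p. matrix_inv (s p) ** partial2 s p
                  = (- 2) *\<^sub>R (\<Phi> 1 p ** v p ** matrix_inv (\<Phi> 1 p)))))
     \<and>
     (\<forall>s :: real \<times> real \<Rightarrow> complex^'n^'n. wave_map (s \<circ> light_cone) \<and> s (0, 0) = mat 1 \<longrightarrow>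
        (\<exists>!\<psi>. is_half_solution s \<psi>) \<and>
        (\<forall>\<psi>. is_half_solution s \<psi> \<longrightarrow>
          (let a = (\<lambda>(\<xi>, \<eta>). (1/2) *\<^sub>R (matrix_inv (s (\<xi>, 0)) ** partial1 s (\<xi>, 0)));
               u = (\<lambda>p. a p - partial1 \<psi> p ** matrix_inv (\<psi> p));
               v = (\<lambda>p. - (1/2) *\<^sub>R
                      (\<psi> p ** (matrix_inv (s p) ** partial2 s p) ** matrix_inv (\<psi> p)))
           in minus_one_flow_solution (\<lambda>p. - a p) u v \<and>
              s = corresponding_wave_map (\<lambda>p. - a p) u v)))"
proof (intro conjI allI impI)
  fix a u v :: "real \<times> real \<Rightarrow> complex^'n^'n"
  assume "minus_one_flow_solution a u v"
  from flow_imp_wave_map[OF this]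
  show "let \<Phi> = flow_trivialization a u v; s = corresponding_wave_map a u v in
      wave_map (s \<circ> light_cone) \<and>
      (\<forall>p. matrix_inv (s p) ** partial1 s p = (- 2) *\<^sub>R (\<Phi> 1 p ** a p ** matrix_inv (\<Phi> 1 p))) \<and>
      (\<forall>p. matrix_inv (s p) ** partial2 s p = (- 2) *\<^sub>R (\<Phi> 1 p ** v p ** matrix_inv (\<Phi> 1 p)))"
    unfolding Let_def by blast
next
  fix s :: "real \<times> real \<Rightarrow> complex^'n^'n"
  assume asm: "wave_map (s \<circ> light_cone) \<and> s (0, 0) = mat 1"
  then have s: "smooth s" "\<And>p. s p \<in> SU"
    unfolding wave_map_light_cone_iff by blast+
  have su: "(1 / 2) *\<^sub>R (conj_transpose (s p) ** partial2 s p) \<in> su" for p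
    using su_scaleR[OF SU_logarithmic_derivative[OF smooth_has_partial2[OF s(1)] s(2)],
        of "1 / 2" "fst p" "snd p"] by simp
  have "smooth (\<lambda>p. (1 / 2) *\<^sub>R (conj_transpose (s p) ** partial2 s p))"
    by (intro smooth_scaleR smooth_mult smooth_conj_transpose smooth_partial2 s)
  then obtain Y where Y: "smooth Y" "\<And>p. Y p \<in> SU" "\<And>x. Y (x, 0) = mat 1"
      "\<And>x y. ((\<lambda>t. Y (x, t)) has_vector_derivative
        Y (x, y) ** ((1 / 2) *\<^sub>R (conj_transpose (s (x, y)) ** partial2 s (x, y)))) (at y)"
    using su_ode_exists[of "\<lambda>p. (1 / 2) *\<^sub>R (conj_transpose (s p) ** partial2 s p)"] su by blast
  \<comment> \<open>This settles existence and uniqueness at once and reduces the claims about an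
    arbitrary \<psi> to the smooth SU(n)-valued \<open>Y\<close>.\<close>
  have iff: "is_half_solution s \<psi> \<longleftrightarrow> \<psi> = Y" for \<psi>
    by (rule is_half_solution_iff[OF s Y(2-4)])
  then show "\<exists>!\<psi>. is_half_solution s \<psi>"
    by simp
  fix \<psi> assume "is_half_solution s \<psi>"
  then have "\<psi> = Y"
    by (simp add: iff)
  then show "let a = (\<lambda>(\<xi>, \<eta>). (1/2) *\<^sub>R (matrix_inv (s (\<xi>, 0)) ** partial1 s (\<xi>, 0)));
      u = (\<lambda>p. a p - partial1 \<psi> p ** matrix_inv (\<psi> p));
      v = (\<lambda>p. - (1/2) *\<^sub>R (\<psi> p ** (matrix_inv (s p) ** partial2 s p) ** matrix_inv (\<psi> p)))
    in minus_one_flow_solution (\<lambda>p. - a p) u v \<and> s = corresponding_wave_map (\<lambda>p. - a p) u v"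
    using wave_map_imp_flow[OF _ _ Y] asm
    by (simp add: Let_def case_prod_unfold SU_matrix_inv[OF s(2)] SU_matrix_inv[OF Y(2)])
qed

end
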